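(* For each $h\in\{0,-1\}$ there exists an overtwisted contact structure on $\mathbb{S}^3$ with Hopf invariant (Hopf class) $h$ for which the round metric of $\mathbb{S}^3$ is a weakly compatible metric.
   Context: All objects are smooth. A contact form on a 3-manifold is a 1-form $\alpha$ with $\alpha\wedge d\alpha\neq0$ everywhere; the contact structure is the plane field $\ker\alpha$. It is overtwisted if there is an embedded disk tangent to the contact planes along its boundary. A Riemannian metric $g$ is weakly compatible with the contact structure defined by $\alpha$ if there is a positive function $f$ with $\ast d\alpha=f\alpha$, where $\ast$ is the Hodge star of $g$. $\mathbb{S}^3=\{(z_1,z_2)\in\mathbb{C}^2:|z_1|^2+|z_2|^2=1\}$ has the round (unit sphere) metric, $z_j=x_j+iy_j$. The standard orthonormal global frame is $R=-y_1\partial_{x_1}+x_1\partial_{y_1}-y_2\partial_{x_2}+x_2\partial_{y_2}$, $X_1=-x_2\partial_{x_1}+y_2\partial_{y_1}+x_1\partial_{x_2}-y_1\partial_{y_2}$, $X_2=-y_2\partial_{x_1}-x_2\partial_{y_1}+y_1\partial_{x_2}+x_1\partial_{y_2}$, and $\mathbb{S}^3$ is oriented so that $\{R,X_1,X_2\}$ is positive. Hopf invariant (Hopf class) of a contact structure $\ker\alpha$ on $\mathbb{S}^3$: let $V$ be the Reeb field of $\alpha$ (the field with $\alpha(V)=1$, $i_Vd\alpha=0$); when $\ast d\alpha=f\alpha$ with $f>0$, this is a positive multiple of the metric dual of $\alpha$. Write $V=fR+f_1X_1+f_2X_2$ (with new coefficient functions $f,f_1,f_2$) and let $\varphi_V=(f,f_1,f_2)/\sqrt{f^2+f_1^2+f_2^2}:\mathbb{S}^3\to\mathbb{S}^2$.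 The Hopf invariant is that of $\varphi_V$, given by Whitehead's formula $\frac{1}{16\pi^2}\int_{\mathbb{S}^3}\mathcal{A}\wedge d\mathcal{A}$, where $d\mathcal{A}=\varphi_V^*\Omega$ and $\Omega=x\,dy\wedge dz+y\,dz\wedge dx+z\,dx\wedge dy$ is the area form of $\mathbb{S}^2$. *)

theory Defs
  imports "HOL-Analysis.Analysis"
begin

section \<open>Smooth maps\<close>

primrec Ck_on :: "nat \<Rightarrow> 'a::euclidean_space set \<Rightarrow> ('a \<Rightarrow> 'b::euclidean_space) \<Rightarrow> bool" where
  "Ck_on 0 S f \<longleftrightarrow> continuous_on S f"
| "Ck_on (Suc k) S f \<longleftrightarrow> (\<forall>x\<in>S. f differentiable (at x)) \<and>
     (\<forall>v. Ck_on k S (\<lambda>x. frechet_derivative f (at x) v))"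

text \<open>Only used for open sets \<open>S\<close>.\<close>

definition smooth_on :: "'a::euclidean_space set \<Rightarrow> ('a \<Rightarrow> 'b::euclidean_space) \<Rightarrow> bool" where
  "smooth_on S f \<longleftrightarrow> (\<forall>k. Ck_on k S f)"


section \<open>The three-sphere and its standard frame\<close>

text \<open>
  The ambient space is \<open>\<complex>\<^sup>2\<close>, with \<open>(z\<^sub>1, z\<^sub>2) = (x\<^sub>1 + \<i> y\<^sub>1, x\<^sub>2 + \<i> y\<^sub>2)\<close>; its inner product as
  a real vector space is the Euclidean one.

  Smooth functions, vector fields and forms on the sphere are represented by smooth ones on an
  open neighbourhood of it in \<open>\<complex>\<^sup>2\<close> (every smooth object on the sphere has such an extension).
  All conditions below involve only points of the sphere and tangent vectors, so they do not
  depend on the extension. In particular the exterior derivative commutes with restriction.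
\<close>

type_synonym C2 = "complex \<times> complex"

abbreviation S3 :: "C2 set" where
  "S3 \<equiv> sphere 0 1"

definition tangent_S3 :: "C2 \<Rightarrow> C2 set" where
  "tangent_S3 p = {v. v \<bullet> p = 0}"

definition frame_R :: "C2 \<Rightarrow> C2" where
  "frame_R = (\<lambda>(z1, z2). (Complex (- Im z1) (Re z1), Complex (- Im z2) (Re z2)))"

definition frame_X1 :: "C2 \<Rightarrow> C2" where
  "frame_X1 = (\<lambda>(z1, z2). (Complex (- Re z2) (Im z2), Complex (Re z1) (- Im z1)))"

definition frame_X2 :: "C2 \<Rightarrow> C2" where
  "frame_X2 = (\<lambda>(z1, z2). (Complex (- Im z2) (- Re z2), Complex (Im z1) (Re z1)))"

definition frame_coords :: "C2 \<Rightarrow> C2 \<Rightarrow> real ^ 3" where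
  "frame_coords p v = vector [v \<bullet> frame_R p, v \<bullet> frame_X1 p, v \<bullet> frame_X2 p]"

definition positively_oriented :: "C2 \<Rightarrow> C2 \<Rightarrow> C2 \<Rightarrow> C2 \<Rightarrow> bool" where
  "positively_oriented p u v w \<longleftrightarrow>
     det (vector [frame_coords p u, frame_coords p v, frame_coords p w] :: real ^ 3 ^ 3) > 0"

definition smooth_near_S3 :: "(C2 \<Rightarrow> 'b::euclidean_space) \<Rightarrow> bool" where
  "smooth_near_S3 f \<longleftrightarrow> (\<exists>U. open U \<and> S3 \<subseteq> U \<and> smooth_on U f)"

definition smooth_vector_field :: "(C2 \<Rightarrow> C2) \<Rightarrow> bool" where
  "smooth_vector_field V \<longleftrightarrow> smooth_near_S3 V \<and> (\<forall>p\<in>S3. V p \<in> tangent_S3 p)"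


section \<open>Differential forms\<close>

type_synonym one_form = "C2 \<Rightarrow> C2 \<Rightarrow> real"

definition smooth_one_form :: "one_form \<Rightarrow> bool" where
  "smooth_one_form \<alpha> \<longleftrightarrow>
     (\<exists>U. open U \<and> S3 \<subseteq> U \<and> (\<forall>p\<in>U. linear (\<alpha> p)) \<and> (\<forall>v. smooth_on U (\<lambda>p. \<alpha> p v)))"

text \<open>
  \<open>d\<alpha>(u,v) = u(\<alpha>(v)) - v(\<alpha>(u))\<close> for constant ambient vector fields \<open>u\<close>, \<open>v\<close>.
\<close>

definition ext_deriv :: "one_form \<Rightarrow> C2 \<Rightarrow> C2 \<Rightarrow> C2 \<Rightarrow> real" where
  "ext_deriv \<alpha> p u v =
     frechet_derivative (\<lambda>x. \<alpha> x v) (at p) u - frechet_derivative (\<lambda>x. \<alpha> x u) (at p) v"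

definition wedge12 :: "('a \<Rightarrow> real) \<Rightarrow> ('a \<Rightarrow> 'a \<Rightarrow> real) \<Rightarrow> 'a \<Rightarrow> 'a \<Rightarrow> 'a \<Rightarrow> real" where
  "wedge12 \<eta> \<beta> u v w = \<eta> u * \<beta> v w + \<eta> v * \<beta> w u + \<eta> w * \<beta> u v"

text \<open>
  The integral of a 3-form \<open>\<omega>\<close> over the oriented sphere is the integral of the function
  \<open>\<omega>(R, X\<^sub>1, X\<^sub>2)\<close> against the round volume. Up to null sets, the Hopf coordinates
  parametrize the sphere, and in them the round metric is
  \<open>ds\<^sup>2 + cos\<^sup>2 s da\<^sup>2 + sin\<^sup>2 s db\<^sup>2\<close>, with volume density \<open>cos s sin s\<close>.
\<close>

definition hopf_param :: "real \<times> real \<times> real \<Rightarrow> C2" where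
  "hopf_param = (\<lambda>(s, a, b). (of_real (cos s) * cis a, of_real (sin s) * cis b))"

definition S3_integral :: "(C2 \<Rightarrow> C2 \<Rightarrow> C2 \<Rightarrow> C2 \<Rightarrow> real) \<Rightarrow> real" where
  "S3_integral \<omega> = integral (cbox (0, 0, 0) (pi / 2, 2 * pi, 2 * pi))
     (\<lambda>(s, a, b). let p = hopf_param (s, a, b)
        in \<omega> p (frame_R p) (frame_X1 p) (frame_X2 p) * (cos s * sin s))"


section \<open>Contact structures\<close>

definition contact_form :: "one_form \<Rightarrow> bool" where
  "contact_form \<alpha> \<longleftrightarrow> smooth_one_form \<alpha> \<and>
     (\<forall>p\<in>S3. wedge12 (\<alpha> p) (ext_deriv \<alpha> p) (frame_R p) (frame_X1 p) (frame_X2 p) \<noteq> 0)"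

definition contact_planes :: "one_form \<Rightarrow> C2 \<Rightarrow> C2 set" where
  "contact_planes \<alpha> p = {v \<in> tangent_S3 p. \<alpha> p v = 0}"

definition embedded_disk :: "(complex \<Rightarrow> C2) \<Rightarrow> bool" where
  "embedded_disk F \<longleftrightarrow>
     (\<exists>D. open D \<and> cball 0 1 \<subseteq> D \<and> smooth_on D F) \<and>
     F ` cball 0 1 \<subseteq> S3 \<and> inj_on F (cball 0 1) \<and>
     (\<forall>x\<in>cball 0 1. inj (frechet_derivative F (at x)))"

definition overtwisted :: "(C2 \<Rightarrow> C2 set) \<Rightarrow> bool" where
  "overtwisted \<xi> \<longleftrightarrow>
     (\<exists>F. embedded_disk F \<and> (\<forall>x\<in>sphere 0 1. range (frechet_derivative F (at x)) = \<xi> (F x)))"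


section \<open>Metrics and weak compatibility\<close>

definition riemannian_metric :: "(C2 \<Rightarrow> C2 \<Rightarrow> C2 \<Rightarrow> real) \<Rightarrow> bool" where
  "riemannian_metric g \<longleftrightarrow>
     (\<exists>U. open U \<and> S3 \<subseteq> U \<and> (\<forall>p\<in>U. bilinear (g p)) \<and> (\<forall>u v. smooth_on U (\<lambda>p. g p u v))) \<and>
     (\<forall>p\<in>S3. \<forall>u\<in>tangent_S3 p. (\<forall>v\<in>tangent_S3 p. g p u v = g p v u) \<and>
        (u \<noteq> 0 \<longrightarrow> g p u u > 0))"

definition round_metric :: "C2 \<Rightarrow> C2 \<Rightarrow> C2 \<Rightarrow> real" where
  "round_metric p u v = u \<bullet> v"

definition oriented_orthonormal ::
    "(C2 \<Rightarrow> C2 \<Rightarrow> C2 \<Rightarrow> real) \<Rightarrow> C2 \<Rightarrow> C2 \<Rightarrow> C2 \<Rightarrow> C2 \<Rightarrow> bool" where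
  "oriented_orthonormal g p e1 e2 e3 \<longleftrightarrow>
     e1 \<in> tangent_S3 p \<and> e2 \<in> tangent_S3 p \<and> e3 \<in> tangent_S3 p \<and>
     g p e1 e1 = 1 \<and> g p e2 e2 = 1 \<and> g p e3 e3 = 1 \<and>
     g p e1 e2 = 0 \<and> g p e2 e3 = 0 \<and> g p e3 e1 = 0 \<and>
     positively_oriented p e1 e2 e3"

text \<open>
  \<open>\<eta> = \<star>\<beta>\<close> on the tangent space at \<open>p\<close>, for a 2-form \<open>\<beta>\<close>: the Hodge star sends
  \<open>e\<^sup>2 \<and> e\<^sup>3\<close> to \<open>e\<^sup>1\<close> for the dual coframe of every positive orthonormal frame. The other two
  components are covered because cyclic shifts of such a frame are again positive and
  orthonormal.
\<close>

definition is_hodge_star ::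
    "(C2 \<Rightarrow> C2 \<Rightarrow> C2 \<Rightarrow> real) \<Rightarrow> C2 \<Rightarrow> (C2 \<Rightarrow> C2 \<Rightarrow> real) \<Rightarrow> (C2 \<Rightarrow> real) \<Rightarrow> bool" where
  "is_hodge_star g p \<beta> \<eta> \<longleftrightarrow>
     (\<forall>e1 e2 e3. oriented_orthonormal g p e1 e2 e3 \<longrightarrow> \<eta> e1 = \<beta> e2 e3)"

definition weakly_compatible :: "(C2 \<Rightarrow> C2 \<Rightarrow> C2 \<Rightarrow> real) \<Rightarrow> one_form \<Rightarrow> bool" where
  "weakly_compatible g \<alpha> \<longleftrightarrow> riemannian_metric g \<and>
     (\<exists>f. smooth_near_S3 f \<and>
        (\<forall>p\<in>S3. f p > 0 \<and> is_hodge_star g p (ext_deriv \<alpha> p) (\<lambda>v. f p * \<alpha> p v)))"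


section \<open>The Hopf invariant\<close>

definition reeb_field :: "one_form \<Rightarrow> (C2 \<Rightarrow> C2) \<Rightarrow> bool" where
  "reeb_field \<alpha> V \<longleftrightarrow> smooth_vector_field V \<and>
     (\<forall>p\<in>S3. \<alpha> p (V p) = 1 \<and> (\<forall>u\<in>tangent_S3 p. ext_deriv \<alpha> p (V p) u = 0))"

definition gauss_map :: "(C2 \<Rightarrow> C2) \<Rightarrow> C2 \<Rightarrow> real \<times> real \<times> real" where
  "gauss_map V p = sgn (V p \<bullet> frame_R p, V p \<bullet> frame_X1 p, V p \<bullet> frame_X2 p)"

definition area_form ::
    "real \<times> real \<times> real \<Rightarrow> real \<times> real \<times> real \<Rightarrow> real \<times> real \<times> real \<Rightarrow> real" where
  "area_form = (\<lambda>(x, y, z) (u1, u2, u3) (v1, v2, v3).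
     x * (u2 * v3 - u3 * v2) + y * (u3 * v1 - u1 * v3) + z * (u1 * v2 - u2 * v1))"

definition pullback_area :: "(C2 \<Rightarrow> real \<times> real \<times> real) \<Rightarrow> C2 \<Rightarrow> C2 \<Rightarrow> C2 \<Rightarrow> real" where
  "pullback_area \<phi> p u v =
     area_form (\<phi> p) (frechet_derivative \<phi> (at p) u) (frechet_derivative \<phi> (at p) v)"

text \<open>
  The Reeb field on the sphere and the number given by Whitehead's formula are uniquely
  determined: on the sphere every closed 1-form is exact, so the integral does not depend on
  the choice of the primitive \<open>A\<close>.
\<close>

definition has_hopf_invariant :: "one_form \<Rightarrow> real \<Rightarrow> bool" where
  "has_hopf_invariant \<alpha> h \<longleftrightarrow>
     (\<exists>V A. reeb_field \<alpha> V \<and> smooth_one_form A \<and>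
        (\<forall>p\<in>S3. \<forall>u\<in>tangent_S3 p. \<forall>v\<in>tangent_S3 p.
           ext_deriv A p u v = pullback_area (gauss_map V) p u v) \<and>
        h = 1 / (16 * pi\<^sup>2) * S3_integral (\<lambda>p. wedge12 (A p) (ext_deriv A p)))"

end

theory Submission
  imports Defs
begin

text \<open>
  Write \<open>u = \<bar>z\<^sub>2\<bar>\<^sup>2\<close>, and let \<open>\<theta>\<^sub>1\<close>, \<open>\<theta>\<^sub>2\<close> be the angles of \<open>z\<^sub>1\<close>, \<open>z\<^sub>2\<close>. A torus invariant form
  \<open>A(u) d\<theta>\<^sub>1 + B(u) d\<theta>\<^sub>2\<close> with \<open>A(1) = B(0) = 0\<close> satisfies \<open>\<star>d\<alpha> = 2n \<alpha>\<close> on the round sphere iff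
  \<open>(1 - u) B' = n A\<close> and \<open>u A' = - n B\<close>. For every integer \<open>n \<ge> 1\<close> this system has a solution by
  polynomials of degree \<open>n\<close> without common zeros; along it the plane field turns by \<open>(2n - 1)\<pi>/2\<close>
  from one core circle to the other. For \<open>n \<ge> 2\<close> this exceeds \<open>\<pi>\<close>: \<open>B\<close> has a zero \<open>c\<close> in \<open>(0, 1)\<close>, and
  the disk \<open>{\<theta>\<^sub>1 = 0, u \<le> c}\<close> is overtwisted. The Gauss map is \<open>(C, S \<i> exp (\<i>(\<theta>\<^sub>1 + \<theta>\<^sub>2)))\<close> with \<open>C\<close> and \<open>S\<close>
  functions of \<open>u\<close>, where \<open>C(0) = 1\<close> and \<open>C(1) = \<kappa> = \<plusminus>1\<close>. The area form pulls back to
  \<open>- dC \<and> (d\<theta>\<^sub>1 + d\<theta>\<^sub>2)\<close>, with primitive \<open>(\<kappa> - C) d\<theta>\<^sub>1 + (1 - C) d\<theta>\<^sub>2\<close>, and Whitehead's integral gives the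
  Hopf invariant \<open>-((\<kappa> - 1)/2)\<^sup>2\<close>. Now \<open>\<kappa> = -1\<close> for \<open>n = 2\<close> and \<open>\<kappa> = 1\<close> for \<open>n = 3\<close>.
\<close>

section \<open>Calculus of smooth maps\<close>

lemma Ck_on_cong:
  assumes "open S" "\<And>x. x \<in> S \<Longrightarrow> f x = g x" "Ck_on k S f"
  shows "Ck_on k S g"
  using assms(2,3)
proof (induction k arbitrary: f g)
  case 0
  then show ?case by (simp cong: continuous_on_cong)
next
  case (Suc k)
  have der: "(g has_derivative frechet_derivative f (at x)) (at x)" if "x \<in> S" for x
    by (rule has_derivative_transform_within_open[of f, OF _ \<open>open S\<close> that])
      (use Suc.prems that in \<open>auto simp: frechet_derivative_works\<close>)
  then have "frechet_derivative f (at x) = frechet_derivative g (at x)" if "x \<in> S" for x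
    using frechet_derivative_at that by blast
  then have eq: "frechet_derivative f (at x) v = frechet_derivative g (at x) v" if "x \<in> S" for x v
    using that by simp
  have "Ck_on k S (\<lambda>x. frechet_derivative g (at x) v)" for v
    by (rule Suc.IH[OF eq]) (use Suc.prems in auto)
  with der show ?case
    unfolding Ck_on.simps(2) differentiable_def by blast
qed

text \<open>\<open>frechet_derivative\<close> is a choice term. Uniqueness of derivatives lets an
  explicit formula replace it on \<open>S\<close>, and openness of \<open>S\<close> carries the
  replacement to the higher derivatives.\<close>

lemma Ck_on_SucI:
  assumes "open S" "\<And>x. x \<in> S \<Longrightarrow> (f has_derivative f' x) (at x)"
    and "\<And>v. Ck_on k S (\<lambda>x. f' x v)"
  shows "Ck_on (Suc k) S f"
proof -
  have eq: "f' x v = frechet_derivative f (at x) v" if "x \<in> S" for x v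
    using frechet_derivative_at[OF assms(2)[OF that]] by simp
  have "Ck_on k S (\<lambda>x. frechet_derivative f (at x) v)" for v
    by (rule Ck_on_cong[OF \<open>open S\<close> eq assms(3)])
  with assms(2) show ?thesis
    unfolding Ck_on.simps(2) differentiable_def by blast
qed

lemma Ck_on_SucD: "Ck_on (Suc k) S f \<Longrightarrow> Ck_on k S f"
proof (induction k arbitrary: f)
  case 0
  then show ?case
    by (auto simp: continuous_on_eq_continuous_within differentiable_imp_continuous_within
        intro: continuous_at_imp_continuous_at_within)
next
  case (Suc k)
  have "Ck_on k S (\<lambda>x. frechet_derivative f (at x) v)" for v
    by (rule Suc.IH) (use Suc.prems in \<open>simp only: Ck_on.simps(2)[of "Suc k"]\<close>)
  with Suc.prems show ?case
    by simp
qed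

lemma Ck_on_Suc_has_derivative:
  assumes "Ck_on (Suc k) S f" "x \<in> S"
  shows "(f has_derivative frechet_derivative f (at x)) (at x)"
  using assms frechet_derivative_works by auto

lemma Ck_on_const: "Ck_on k S (\<lambda>x. c)"
  by (induction k arbitrary: c) auto

lemma Ck_on_bounded_linear:
  assumes "bounded_linear f"
  shows "Ck_on k S f"
proof (cases k)
  case 0
  then show ?thesis using assms linear_continuous_on by auto
next
  case (Suc j)
  have *: "(f has_derivative f) (at x)" for x
    by (rule bounded_linear_imp_has_derivative[OF assms])
  have "frechet_derivative f (at x) = f" for x
    using frechet_derivative_at[OF *] by simp
  with * show ?thesis
    unfolding Suc by (auto simp: differentiable_def Ck_on_const)
qed

lemma Ck_on_add:
  assumes "open S" "Ck_on k S f" "Ck_on k S g"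
  shows "Ck_on k S (\<lambda>x. f x + g x)"
  using assms(2,3)
proof (induction k arbitrary: f g)
  case 0
  then show ?case by (auto intro: continuous_intros)
next
  case (Suc k)
  show ?case
  proof (rule Ck_on_SucI[OF \<open>open S\<close>])
    fix x assume "x \<in> S"
    then show "((\<lambda>x. f x + g x) has_derivative
      (\<lambda>v. frechet_derivative f (at x) v + frechet_derivative g (at x) v)) (at x)"
      using Suc.prems by (intro has_derivative_add Ck_on_Suc_has_derivative)
  qed (use Suc in auto)
qed

lemma Ck_on_bounded_bilinear:
  fixes prod :: "'b::euclidean_space \<Rightarrow> 'c::euclidean_space \<Rightarrow> 'd::euclidean_space"
  assumes "bounded_bilinear prod" "open S" "Ck_on k S f" "Ck_on k S g"
  shows "Ck_on k S (\<lambda>x. prod (f x) (g x))"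
  using assms(3,4)
proof (induction k arbitrary: f g)
  case 0
  then show ?case using bounded_bilinear.continuous_on[OF assms(1)] by auto
next
  case (Suc k)
  show ?case
  proof (rule Ck_on_SucI[OF \<open>open S\<close>])
    fix x assume "x \<in> S"
    then show "((\<lambda>x. prod (f x) (g x)) has_derivative
      (\<lambda>v. prod (f x) (frechet_derivative g (at x) v)
         + prod (frechet_derivative f (at x) v) (g x))) (at x)"
      using Suc.prems by (intro bounded_bilinear.FDERIV[OF assms(1)] Ck_on_Suc_has_derivative)
  next
    fix v
    show "Ck_on k S (\<lambda>x. prod (f x) (frechet_derivative g (at x) v)
         + prod (frechet_derivative f (at x) v) (g x))"
      using Suc.prems Suc.prems[THEN Ck_on_SucD]
      by (intro Ck_on_add[OF \<open>open S\<close>] Suc.IH) auto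
  qed
qed

text \<open>A linear map on the line is multiplication by its value at 1, so the chain rule yields a
  product. The induction passes from \<open>f\<close> to its derivative while \<open>g\<close> stays
  fixed.\<close>

lemma Ck_on_compose_real:
  fixes f :: "real \<Rightarrow> real" and g :: "'a::euclidean_space \<Rightarrow> real"
  assumes "open S" "Ck_on k UNIV f" "Ck_on k S g"
  shows "Ck_on k S (\<lambda>x. f (g x))"
  using assms(2,3)
proof (induction k arbitrary: f)
  case 0
  then show ?case using continuous_on_compose2[of UNIV f S g] by simp
next
  case (Suc k)
  show ?case
  proof (rule Ck_on_SucI[OF \<open>open S\<close>])
    fix x assume x: "x \<in> S"
    have f: "(f has_derivative frechet_derivative f (at (g x))) (at (g x))"
      using Suc.prems by (intro Ck_on_Suc_has_derivative) auto
    have "f' r = r * f' 1" if "linear f'" for f' :: "real \<Rightarrow> real" and r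
      using linear_scale[OF that, of r 1] by simp
    from this[OF has_derivative_linear[OF f]]
    have *: "(\<lambda>v. frechet_derivative f (at (g x)) (frechet_derivative g (at x) v))
      = (\<lambda>v. frechet_derivative g (at x) v * frechet_derivative f (at (g x)) 1)"
      by (rule ext)
    show "((\<lambda>x. f (g x)) has_derivative
      (\<lambda>v. frechet_derivative g (at x) v * frechet_derivative f (at (g x)) 1)) (at x)"
      using has_derivative_compose[OF Ck_on_Suc_has_derivative[OF Suc.prems(2) x] f]
      unfolding * .
  next
    fix v
    show "Ck_on k S (\<lambda>x. frechet_derivative g (at x) v * frechet_derivative f (at (g x)) 1)"
      using Suc.prems Ck_on_SucD[OF Suc.prems(2)]
      by (intro Ck_on_bounded_bilinear[OF bounded_bilinear_mult \<open>open S\<close>]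
          Suc.IH[of "\<lambda>y. frechet_derivative f (at y) 1"]) auto
  qed
qed

text \<open>The derivative is a product of \<open>f'\<close> and copies of
  \<open>inverse (f x)\<close>, so the induction hypothesis for the same \<open>f\<close> applies.
  The sign is a constant factor \<open>- 1\<close> to fit the product rule.\<close>

lemma Ck_on_inverse:
  fixes f :: "'a::euclidean_space \<Rightarrow> real"
  assumes "open S" "Ck_on k S f" and nz: "\<And>x. x \<in> S \<Longrightarrow> f x \<noteq> 0"
  shows "Ck_on k S (\<lambda>x. inverse (f x))"
  using assms(2)
proof (induction k)
  case 0
  then show ?case using nz by (auto intro: continuous_intros)
next
  case (Suc k)
  show ?case
  proof (rule Ck_on_SucI[OF \<open>open S\<close>])
    fix x assume "x \<in> S"
    then show "((\<lambda>x. inverse (f x)) has_derivative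
      (\<lambda>v. - 1 * (inverse (f x) * (frechet_derivative f (at x) v * inverse (f x))))) (at x)"
      using Deriv.has_derivative_inverse[OF nz[of x] Ck_on_Suc_has_derivative[OF Suc.prems]]
      by (simp add: mult_ac)
  next
    fix v
    show "Ck_on k S (\<lambda>x. - 1 * (inverse (f x) * (frechet_derivative f (at x) v * inverse (f x))))"
      using Suc Ck_on_SucD[OF Suc.prems]
      by (intro Ck_on_bounded_bilinear[OF bounded_bilinear_mult \<open>open S\<close>] Ck_on_const) auto
  qed
qed

lemma Ck_on_sqrt:
  fixes f :: "'a::euclidean_space \<Rightarrow> real"
  assumes "open S" "Ck_on k S f" and pos: "\<And>x. x \<in> S \<Longrightarrow> f x > 0"
  shows "Ck_on k S (\<lambda>x. sqrt (f x))"
  using assms(2)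
proof (induction k)
  case 0
  then show ?case by (auto intro: continuous_intros)
next
  case (Suc k)
  show ?case
  proof (rule Ck_on_SucI[OF \<open>open S\<close>])
    fix x assume "x \<in> S"
    then show "((\<lambda>x. sqrt (f x)) has_derivative
      (\<lambda>v. (1/2) * (frechet_derivative f (at x) v * inverse (sqrt (f x))))) (at x)"
      using has_derivative_real_sqrt[OF pos[of x] Ck_on_Suc_has_derivative[OF Suc.prems]]
      by (simp add: field_simps)
  next
    fix v
    show "Ck_on k S (\<lambda>x. (1/2) * (frechet_derivative f (at x) v * inverse (sqrt (f x))))"
      using Suc Ck_on_SucD[OF Suc.prems]
      by (intro Ck_on_bounded_bilinear[OF bounded_bilinear_mult \<open>open S\<close>] Ck_on_const
          Ck_on_inverse[OF \<open>open S\<close>]) (auto dest: pos)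
  qed
qed

section \<open>Closure properties of smooth maps\<close>

lemma smooth_on_const: "smooth_on S (\<lambda>x. c)"
  by (simp add: smooth_on_def Ck_on_const)

lemma smooth_on_bounded_linear: "bounded_linear f \<Longrightarrow> smooth_on S f"
  by (simp add: smooth_on_def Ck_on_bounded_linear)

lemma smooth_on_add:
  "\<lbrakk>open S; smooth_on S f; smooth_on S g\<rbrakk> \<Longrightarrow> smooth_on S (\<lambda>x. f x + g x)"
  by (simp add: smooth_on_def Ck_on_add)

lemma smooth_on_scaleR:
  "\<lbrakk>open S; smooth_on S f; smooth_on S g\<rbrakk> \<Longrightarrow> smooth_on S (\<lambda>x. f x *\<^sub>R g x)"
  by (simp add: smooth_on_def Ck_on_bounded_bilinear[OF bounded_bilinear_scaleR])

lemma smooth_on_mult: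
  fixes f g :: "'a::euclidean_space \<Rightarrow> real"
  shows "\<lbrakk>open S; smooth_on S f; smooth_on S g\<rbrakk> \<Longrightarrow> smooth_on S (\<lambda>x. f x * g x)"
  using smooth_on_scaleR[of S f g] by simp

lemma smooth_on_power:
  fixes f :: "'a::euclidean_space \<Rightarrow> real"
  shows "\<lbrakk>open S; smooth_on S f\<rbrakk> \<Longrightarrow> smooth_on S (\<lambda>x. f x ^ k)"
  by (induction k) (auto intro: smooth_on_mult smooth_on_const)

lemma smooth_on_diff:
  fixes f g :: "'a::euclidean_space \<Rightarrow> real"
  assumes "open S" "smooth_on S f" "smooth_on S g"
  shows "smooth_on S (\<lambda>x. f x - g x)"
  using smooth_on_add[OF assms(1,2) smooth_on_mult[OF assms(1) smooth_on_const[of S "- 1"] assms(3)]]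
  by simp

lemma smooth_on_inverse:
  fixes f :: "'a::euclidean_space \<Rightarrow> real"
  shows "\<lbrakk>open S; smooth_on S f; \<And>x. x \<in> S \<Longrightarrow> f x \<noteq> 0\<rbrakk> \<Longrightarrow> smooth_on S (\<lambda>x. inverse (f x))"
  by (simp add: smooth_on_def Ck_on_inverse)

lemma smooth_on_divide:
  fixes f g :: "'a::euclidean_space \<Rightarrow> real"
  shows "\<lbrakk>open S; smooth_on S f; smooth_on S g; \<And>x. x \<in> S \<Longrightarrow> g x \<noteq> 0\<rbrakk>
    \<Longrightarrow> smooth_on S (\<lambda>x. f x / g x)"
  unfolding divide_inverse by (intro smooth_on_mult smooth_on_inverse)

lemma smooth_on_sqrt:
  fixes f :: "'a::euclidean_space \<Rightarrow> real"
  shows "\<lbrakk>open S; smooth_on S f; \<And>x. x \<in> S \<Longrightarrow> f x > 0\<rbrakk> \<Longrightarrow> smooth_on S (\<lambda>x. sqrt (f x))"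
  by (simp add: smooth_on_def Ck_on_sqrt)

lemma smooth_on_compose_real:
  fixes f :: "real \<Rightarrow> real" and g :: "'a::euclidean_space \<Rightarrow> real"
  shows "\<lbrakk>smooth_on UNIV f; open S; smooth_on S g\<rbrakk> \<Longrightarrow> smooth_on S (\<lambda>x. f (g x))"
  by (simp add: smooth_on_def Ck_on_compose_real)

lemmas smooth_on_intros = smooth_on_const smooth_on_add smooth_on_diff smooth_on_mult
  smooth_on_power smooth_on_divide smooth_on_sqrt smooth_on_scaleR

lemma smooth_on_UNIV_real:
  fixes f :: "real \<Rightarrow> real"
  assumes "smooth_on UNIV f"
  shows has_deriv_smooth: "(f has_real_derivative deriv f x) (at x)"
    and continuous_on_deriv_smooth: "continuous_on UNIV (deriv f)"
proof -
  have C1: "Ck_on (Suc 0) UNIV f"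
    using assms by (simp only: smooth_on_def)
  show *: "(f has_real_derivative deriv f x) (at x)" for x
    using C1 by (auto simp: DERIV_deriv_iff_real_differentiable)
  then have "frechet_derivative f (at x) = (\<lambda>v. deriv f x * v)" for x
    using frechet_derivative_at[of f "(\<lambda>v. deriv f x * v)" x] has_field_derivative_def by metis
  moreover have "continuous_on UNIV (\<lambda>x. frechet_derivative f (at x) 1)"
    using C1 by simp
  ultimately show "continuous_on UNIV (deriv f)"
    by simp
qed


section \<open>The frame of the three-sphere\<close>

lemma mem_S3_iff:
  "p \<in> S3 \<longleftrightarrow> (Re (fst p))\<^sup>2 + (Im (fst p))\<^sup>2 + ((Re (snd p))\<^sup>2 + (Im (snd p))\<^sup>2) = 1"
  by (cases p) (simp add: norm_Pair cmod_power2 real_sqrt_eq_1_iff)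

lemma inner_C2: "(v :: C2) \<bullet> w = Re (fst v) * Re (fst w) + Im (fst v) * Im (fst w)
    + (Re (snd v) * Re (snd w) + Im (snd v) * Im (snd w))"
  by (simp add: inner_prod_def inner_complex_def)

lemma C2_eq_iff: "(v :: C2) = w \<longleftrightarrow> Re (fst v) = Re (fst w) \<and> Im (fst v) = Im (fst w)
    \<and> Re (snd v) = Re (snd w) \<and> Im (snd v) = Im (snd w)"
  by (auto simp: prod_eq_iff complex_eq_iff)

lemma frame_components [simp]:
  "fst (frame_R p) = Complex (- Im (fst p)) (Re (fst p))"
  "snd (frame_R p) = Complex (- Im (snd p)) (Re (snd p))"
  "fst (frame_X1 p) = Complex (- Re (snd p)) (Im (snd p))"
  "snd (frame_X1 p) = Complex (Re (fst p)) (- Im (fst p))"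
  "fst (frame_X2 p) = Complex (- Im (snd p)) (- Re (snd p))"
  "snd (frame_X2 p) = Complex (Im (fst p)) (Re (fst p))"
  by (cases p; simp add: frame_R_def frame_X1_def frame_X2_def)+

text \<open>The frame together with \<open>p\<close> is orthogonal, with all norms equal to that of
  \<open>p\<close>. Homogenizing by \<open>p \<bullet> p\<close> turns the expansion into a
  polynomial identity valid for all \<open>p\<close> and \<open>v\<close>.\<close>

lemma frame_expansion:
  assumes p: "p \<in> S3" and v: "v \<in> tangent_S3 p"
  shows "v = (v \<bullet> frame_R p) *\<^sub>R frame_R p + (v \<bullet> frame_X1 p) *\<^sub>R frame_X1 p
    + (v \<bullet> frame_X2 p) *\<^sub>R frame_X2 p" (is "v = ?w")
proof -
  have "v = (p \<bullet> p) *\<^sub>R v - (v \<bullet> p) *\<^sub>R p"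
    using p v by (simp add: tangent_S3_def flip: power2_norm_eq_inner)
  also have "\<dots> = ?w"
    by (simp add: C2_eq_iff inner_C2 algebra_simps)
  finally show ?thesis .
qed

lemma inner_frame_coords:
  assumes "p \<in> S3" "v \<in> tangent_S3 p"
  shows "frame_coords p v \<bullet> frame_coords p w = v \<bullet> w"
proof -
  have "v \<bullet> w = (v \<bullet> frame_R p) * (frame_R p \<bullet> w) + (v \<bullet> frame_X1 p) * (frame_X1 p \<bullet> w)
    + (v \<bullet> frame_X2 p) * (frame_X2 p \<bullet> w)"
    by (subst frame_expansion[OF assms]) (simp add: inner_add_left)
  then show ?thesis
    by (simp add: frame_coords_def inner_vec_def sum_3 inner_commute)
qed

lemma linear_frame:
  assumes "linear \<eta>" "p \<in> S3" "v \<in> tangent_S3 p"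
  shows "\<eta> v = (v \<bullet> frame_R p) * \<eta> (frame_R p) + (v \<bullet> frame_X1 p) * \<eta> (frame_X1 p)
    + (v \<bullet> frame_X2 p) * (\<eta> (frame_X2 p) :: real)"
  by (subst frame_expansion[OF assms(2,3)])
    (simp add: linear_add[OF assms(1)] linear_scale[OF assms(1)])

lemma alternating_frame:
  fixes \<beta> :: "C2 \<Rightarrow> C2 \<Rightarrow> real"
  assumes "bilinear \<beta>" "\<And>v w. \<beta> v w = - \<beta> w v"
    and "p \<in> S3" "v \<in> tangent_S3 p" "w \<in> tangent_S3 p"
  shows "\<beta> v w =
      \<beta> (frame_X1 p) (frame_X2 p)
        * ((v \<bullet> frame_X1 p) * (w \<bullet> frame_X2 p) - (v \<bullet> frame_X2 p) * (w \<bullet> frame_X1 p))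
    + \<beta> (frame_X2 p) (frame_R p)
        * ((v \<bullet> frame_X2 p) * (w \<bullet> frame_R p) - (v \<bullet> frame_R p) * (w \<bullet> frame_X2 p))
    + \<beta> (frame_R p) (frame_X1 p)
        * ((v \<bullet> frame_R p) * (w \<bullet> frame_X1 p) - (v \<bullet> frame_X1 p) * (w \<bullet> frame_R p))"
proof -
  have lin: "linear (\<beta> v)" "linear (\<lambda>v. \<beta> v w)" for v w
    using assms(1) unfolding bilinear_def by blast+
  have diag: "\<beta> v v = 0" for v
    using assms(2)[of v v] by simp
  have "\<beta> v w = (v \<bullet> frame_R p) * \<beta> (frame_R p) w + (v \<bullet> frame_X1 p) * \<beta> (frame_X1 p) w
    + (v \<bullet> frame_X2 p) * \<beta> (frame_X2 p) w"
    by (rule linear_frame[OF lin(2) assms(3,4)])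
  also have "\<dots> = (v \<bullet> frame_R p) * ((w \<bullet> frame_X1 p) * \<beta> (frame_R p) (frame_X1 p)
      - (w \<bullet> frame_X2 p) * \<beta> (frame_X2 p) (frame_R p))
    + (v \<bullet> frame_X1 p) * ((w \<bullet> frame_X2 p) * \<beta> (frame_X1 p) (frame_X2 p)
      - (w \<bullet> frame_R p) * \<beta> (frame_R p) (frame_X1 p))
    + (v \<bullet> frame_X2 p) * ((w \<bullet> frame_R p) * \<beta> (frame_X2 p) (frame_R p)
      - (w \<bullet> frame_X1 p) * \<beta> (frame_X1 p) (frame_X2 p))"
    using assms(2)[of "frame_R p" "frame_X2 p"] assms(2)[of "frame_X1 p" "frame_R p"]
      assms(2)[of "frame_X2 p" "frame_X1 p"]
    by (simp add: linear_frame[OF lin(1) assms(3,5)] diag)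
  finally show ?thesis
    by (simp add: algebra_simps)
qed

text \<open>A vector orthogonal to \<open>b\<close> and \<open>c\<close> is parallel to
  \<open>cross3 b c\<close>. Both are unit vectors, and the positive determinant fixes the
  sign.\<close>

lemma cross3_of_oriented_orthonormal:
  fixes a b c :: "real ^ 3"
  assumes "a \<bullet> a = 1" "b \<bullet> b = 1" "c \<bullet> c = 1" "a \<bullet> b = 0" "b \<bullet> c = 0" "c \<bullet> a = 0"
    and "det (vector [a, b, c]) > 0"
  shows "a = cross3 b c"
proof -
  have det: "a \<bullet> cross3 b c > 0"
    using assms(7) by (simp add: dot_cross_det)
  have n: "cross3 b c \<bullet> cross3 b c = 1"
    using assms by (simp add: dot_cross inner_commute)
  have "cross3 a (cross3 b c) = 0"
    using assms by (simp add: Lagrange inner_commute)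
  then have "(a \<bullet> cross3 b c)\<^sup>2 = 1"
    using norm_cross[of a "cross3 b c"] n assms(1)
    by (simp add: power2_norm_eq_inner)
  with det have "a \<bullet> cross3 b c = 1"
    by (simp add: power2_eq_1_iff)
  then have "(a - cross3 b c) \<bullet> (a - cross3 b c) = 0"
    using n assms(1) by (simp add: inner_diff inner_commute)
  then show ?thesis by simp
qed

text \<open>The coordinates of \<open>e1\<close> are the 2 by 2 minors of those of \<open>e2\<close>
  and \<open>e3\<close>, which are the coefficients in \<open>alternating_frame\<close>. Hence
  testing the star condition on the standard frame is enough.\<close>

lemma is_hodge_star_roundI:
  assumes p: "p \<in> S3" and \<beta>: "bilinear \<beta>" "\<And>v w. \<beta> v w = - \<beta> w v" and \<eta>: "linear \<eta>"
    and frame: "\<eta> (frame_R p) = \<beta> (frame_X1 p) (frame_X2 p)"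
      "\<eta> (frame_X1 p) = \<beta> (frame_X2 p) (frame_R p)"
      "\<eta> (frame_X2 p) = \<beta> (frame_R p) (frame_X1 p)"
  shows "is_hodge_star round_metric p \<beta> \<eta>"
  unfolding is_hodge_star_def
proof (intro allI impI)
  fix e1 e2 e3 assume e: "oriented_orthonormal round_metric p e1 e2 e3"
  then have t: "e1 \<in> tangent_S3 p" "e2 \<in> tangent_S3 p" "e3 \<in> tangent_S3 p"
    by (auto simp: oriented_orthonormal_def)
  have "frame_coords p e1 = cross3 (frame_coords p e2) (frame_coords p e3)"
    by (rule cross3_of_oriented_orthonormal)
      (use e t p in \<open>auto simp: oriented_orthonormal_def inner_frame_coords round_metric_def
        positively_oriented_def\<close>)
  then have "e1 \<bullet> frame_R p
      = (e2 \<bullet> frame_X1 p) * (e3 \<bullet> frame_X2 p) - (e2 \<bullet> frame_X2 p) * (e3 \<bullet> frame_X1 p)"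
    "e1 \<bullet> frame_X1 p
      = (e2 \<bullet> frame_X2 p) * (e3 \<bullet> frame_R p) - (e2 \<bullet> frame_R p) * (e3 \<bullet> frame_X2 p)"
    "e1 \<bullet> frame_X2 p
      = (e2 \<bullet> frame_R p) * (e3 \<bullet> frame_X1 p) - (e2 \<bullet> frame_X1 p) * (e3 \<bullet> frame_R p)"
    by (auto simp: vec_eq_iff forall_3 cross3_def frame_coords_def)
  then show "\<eta> e1 = \<beta> e2 e3"
    unfolding alternating_frame[OF \<beta> p t(2,3)] linear_frame[OF \<eta> p t(1)] frame by simp
qed

lemma riemannian_round: "riemannian_metric round_metric"
proof -
  have "bilinear (round_metric p)" for p
    unfolding bilinear_def round_metric_def
    by (intro conjI allI linearI) (simp_all only: inner_add_left inner_add_right inner_scaleR_left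
      inner_scaleR_right real_scaleR_def)
  moreover have "smooth_on UNIV (\<lambda>p. round_metric p u v)" for u v
    by (simp add: round_metric_def smooth_on_const)
  ultimately show ?thesis
    unfolding riemannian_metric_def
    by (auto simp: round_metric_def inner_commute)
qed


section \<open>Forms invariant under the torus\<close>

text \<open>In polar coordinates this is \<open>r\<^sup>2 d\<theta>\<close>, which stays smooth at
  the origin, where the angle is undefined.\<close>

definition ang :: "complex \<Rightarrow> complex \<Rightarrow> real" where
  "ang z v = Re z * Im v - Im z * Re v"

definition rho :: "C2 \<Rightarrow> real" where
  "rho z = (Re (snd z))\<^sup>2 + (Im (snd z))\<^sup>2"

text \<open>
  In polar coordinates \<open>z\<^sub>1 = r\<^sub>1 exp (\<i>\<theta>\<^sub>1)\<close>, \<open>z\<^sub>2 = r\<^sub>2 exp (\<i>\<theta>\<^sub>2)\<close> this is \<open>p r\<^sub>1\<^sup>2 d\<theta>\<^sub>1 + q r\<^sub>2\<^sup>2 d\<theta>\<^sub>2\<close>, with \<open>p\<close> and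
  \<open>q\<close> functions of \<open>r\<^sub>2\<^sup>2\<close>.
\<close>

definition torus_form :: "(real \<Rightarrow> real) \<Rightarrow> (real \<Rightarrow> real) \<Rightarrow> one_form" where
  "torus_form p q z v = p (rho z) * ang (fst z) (fst v) + q (rho z) * ang (snd z) (snd v)"

lemma bounded_linear_components:
  "bounded_linear (\<lambda>z::C2. Re (fst z))" "bounded_linear (\<lambda>z::C2. Im (fst z))"
  "bounded_linear (\<lambda>z::C2. Re (snd z))" "bounded_linear (\<lambda>z::C2. Im (snd z))"
  by (intro bounded_linear_compose[OF bounded_linear_Re] bounded_linear_compose[OF bounded_linear_Im]
      bounded_linear_fst bounded_linear_snd)+

lemmas smooth_on_components = bounded_linear_components[THEN smooth_on_bounded_linear]

lemma smooth_on_rho: "smooth_on UNIV rho"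
  unfolding rho_def [abs_def] by (intro smooth_on_intros smooth_on_components) auto

lemma rho_has_derivative [derivative_intros]:
  "(rho has_derivative (\<lambda>h. 2 * (snd z \<bullet> snd h))) (at z)"
  unfolding rho_def [abs_def]
  by (auto intro!: derivative_eq_intros simp: inner_complex_def fun_eq_iff)

lemma smooth_on_compose_rho:
  fixes p :: "real \<Rightarrow> real"
  shows "smooth_on UNIV p \<Longrightarrow> smooth_on UNIV (\<lambda>z. p (rho z))"
  by (rule smooth_on_compose_real[OF _ open_UNIV smooth_on_rho])

lemma linear_torus_form: "linear (torus_form p q z)"
  by (rule linearI) (simp_all add: torus_form_def ang_def algebra_simps)

lemma smooth_torus_form:
  assumes "smooth_on UNIV p" "smooth_on UNIV q"
  shows "smooth_one_form (torus_form p q)"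
proof -
  have "smooth_on UNIV (\<lambda>z. torus_form p q z v)" for v
    unfolding torus_form_def ang_def
    by (intro smooth_on_intros smooth_on_components smooth_on_compose_rho assms open_UNIV)
  then show ?thesis
    unfolding smooth_one_form_def using linear_torus_form by blast
qed

lemma torus_form_has_derivative:
  assumes "(p has_real_derivative p') (at (rho z))" "(q has_real_derivative q') (at (rho z))"
  shows "((\<lambda>x. torus_form p q x v) has_derivative
    (\<lambda>h. p' * (2 * (snd z \<bullet> snd h)) * ang (fst z) (fst v) + p (rho z) * ang (fst h) (fst v)
       + (q' * (2 * (snd z \<bullet> snd h)) * ang (snd z) (snd v) + q (rho z) * ang (snd h) (snd v)))) (at z)"
proof -
  have "((\<lambda>x. p (rho x)) has_derivative (\<lambda>h. p' * (2 * (snd z \<bullet> snd h)))) (at z)"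
    "((\<lambda>x. q (rho x)) has_derivative (\<lambda>h. q' * (2 * (snd z \<bullet> snd h)))) (at z)"
    using assms[unfolded has_field_derivative_def, THEN has_derivative_compose[OF rho_has_derivative]]
    by blast+
  note [derivative_intros] = this
  show ?thesis
    unfolding torus_form_def ang_def
    by (auto intro!: derivative_eq_intros simp: fun_eq_iff algebra_simps)
qed

text \<open>Leibniz rule: \<open>rho\<close> has differential
  \<open>2 * (snd z \<bullet> snd h)\<close>, and \<open>d(r\<^sup>2 d\<theta>)\<close> is
  \<open>2 * ang\<close>.\<close>

lemma ext_deriv_torus_form:
  assumes "(p has_real_derivative p') (at (rho z))" "(q has_real_derivative q') (at (rho z))"
  shows "ext_deriv (torus_form p q) z v w =
      2 * p' * ((snd z \<bullet> snd v) * ang (fst z) (fst w) - (snd z \<bullet> snd w) * ang (fst z) (fst v))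
    + 2 * p (rho z) * ang (fst v) (fst w)
    + 2 * q' * ((snd z \<bullet> snd v) * ang (snd z) (snd w) - (snd z \<bullet> snd w) * ang (snd z) (snd v))
    + 2 * q (rho z) * ang (snd v) (snd w)"
  unfolding ext_deriv_def frechet_derivative_at[OF torus_form_has_derivative[OF assms], symmetric]
  by (simp add: ang_def algebra_simps)

lemma bilinear_ext_deriv_torus_form:
  assumes "smooth_on UNIV p" "smooth_on UNIV q"
  shows "bilinear (ext_deriv (torus_form p q) z)"
  unfolding bilinear_def
  by (auto intro!: linearI simp: ext_deriv_torus_form[OF assms[THEN has_deriv_smooth]]
      ang_def inner_add_right algebra_simps)

lemma ext_deriv_alternating: "ext_deriv \<alpha> z v w = - ext_deriv \<alpha> z w v"
  by (simp add: ext_deriv_def)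

lemma one_minus_rho: "z \<in> S3 \<Longrightarrow> 1 - rho z = (Re (fst z))\<^sup>2 + (Im (fst z))\<^sup>2"
  unfolding mem_S3_iff rho_def by linarith

lemma torus_form_frame:
  assumes "z \<in> S3"
  shows "torus_form p q z (frame_R z) = (1 - rho z) * p (rho z) + rho z * q (rho z)"
    "torus_form p q z (frame_X1 z) = (p (rho z) - q (rho z)) * Im (fst z * snd z)"
    "torus_form p q z (frame_X2 z) = (q (rho z) - p (rho z)) * Re (fst z * snd z)"
proof -
  show "torus_form p q z (frame_R z) = (1 - rho z) * p (rho z) + rho z * q (rho z)"
    unfolding one_minus_rho[OF assms]
    by (simp add: torus_form_def ang_def rho_def power2_eq_square algebra_simps)
qed (simp_all add: torus_form_def ang_def algebra_simps)

lemma norm_fst_times_snd: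
  assumes "z \<in> S3"
  shows "(Re (fst z * snd z))\<^sup>2 + (Im (fst z * snd z))\<^sup>2 = rho z * (1 - rho z)"
  unfolding one_minus_rho[OF assms] by (simp add: rho_def power2_eq_square algebra_simps)

text \<open>\<open>P'\<close> and \<open>Q'\<close> are the derivatives of the angular coefficients
  \<open>(1 - u) p\<close> and \<open>u q\<close>; the curl depends on \<open>p\<close> and
  \<open>q\<close> only through them. As equations they can be met by other known values, such as
  \<open>- C'\<close> below.\<close>

lemma ext_deriv_torus_form_frame:
  assumes z: "z \<in> S3"
    and "(p has_real_derivative p') (at (rho z))" "(q has_real_derivative q') (at (rho z))"
    and P': "P' = (1 - rho z) * p' - p (rho z)" and Q': "Q' = q (rho z) + rho z * q'"
  shows "ext_deriv (torus_form p q) z (frame_X1 z) (frame_X2 z)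
      = 2 * ((1 - rho z) * Q' - rho z * P')"
    "ext_deriv (torus_form p q) z (frame_X2 z) (frame_R z) = 2 * (P' + Q') * Im (fst z * snd z)"
    "ext_deriv (torus_form p q) z (frame_R z) (frame_X1 z) = - 2 * (P' + Q') * Re (fst z * snd z)"
proof -
  note s = one_minus_rho[OF z]
  have r: "rho z = (Re (snd z))\<^sup>2 + (Im (snd z))\<^sup>2"
    by (simp add: rho_def)
  have e: "(1 - rho z) * Q' - rho z * P'
    = rho z * (1 - rho z) * (q' - p') + rho z * p (rho z) + (1 - rho z) * q (rho z)"
    unfolding P' Q' by (simp add: algebra_simps)
  show "ext_deriv (torus_form p q) z (frame_X1 z) (frame_X2 z)
      = 2 * ((1 - rho z) * Q' - rho z * P')"
    unfolding ext_deriv_torus_form[OF assms(2,3)] e unfolding s unfolding r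
    by (simp add: ang_def inner_complex_def power2_eq_square algebra_simps)
  have e: "P' + Q' = (1 - rho z) * p' + rho z * q' + (q (rho z) - p (rho z))"
    unfolding P' Q' by (simp add: algebra_simps)
  show "ext_deriv (torus_form p q) z (frame_X2 z) (frame_R z) = 2 * (P' + Q') * Im (fst z * snd z)"
    "ext_deriv (torus_form p q) z (frame_R z) (frame_X1 z) = - 2 * (P' + Q') * Re (fst z * snd z)"
    unfolding ext_deriv_torus_form[OF assms(2,3)] e unfolding s unfolding r
    by (simp_all add: ang_def inner_complex_def power2_eq_square algebra_simps)
qed


section \<open>Pulling back the area form\<close>

text \<open>\<open>area_form w u v\<close> is the determinant of the three vectors, so adding
  multiples of \<open>w\<close> to the other two changes nothing.\<close>

lemma area_form_scale_shear:
  "area_form (c *\<^sub>R w) (c *\<^sub>R u + k *\<^sub>R w) (c *\<^sub>R v + l *\<^sub>R w) = c ^ 3 * area_form w u v"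
  by (cases u; cases v; cases w) (simp add: area_form_def algebra_simps power3_eq_cube)

text \<open>The coefficient \<open>k h\<close> stays abstract because the area form at
  \<open>W p\<close> kills multiples of \<open>W p\<close>.\<close>

lemma sgn_has_derivative:
  fixes W :: "'a::real_normed_vector \<Rightarrow> 'b::real_inner"
  assumes W: "(W has_derivative W') (at p)" and nz: "W p \<noteq> 0"
  shows "\<exists>k. ((\<lambda>x. sgn (W x)) has_derivative (\<lambda>h. inverse (norm (W p)) *\<^sub>R W' h + k h *\<^sub>R W p)) (at p)"
proof -
  have "(\<lambda>x. norm (W x)) differentiable (at p)"
    using differentiable_compose[of norm W p UNIV] differentiable_norm_at[OF nz] W
    by (auto simp: differentiable_def)
  then have "(\<lambda>x. inverse (norm (W x))) differentiable (at p)"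
    using nz by (intro differentiable_inverse) auto
  then obtain k where k: "((\<lambda>x. inverse (norm (W x))) has_derivative k) (at p)"
    by (auto simp: differentiable_def)
  show ?thesis
    unfolding sgn_div_norm by (rule exI) (rule has_derivative_scaleR[OF k W])
qed

lemma pullback_area_sgn:
  assumes "(W has_derivative W') (at p)" and nz: "W p \<noteq> 0"
  shows "pullback_area (\<lambda>x. sgn (W x)) p u v = area_form (W p) (W' u) (W' v) / norm (W p) ^ 3"
proof -
  obtain k where "((\<lambda>x. sgn (W x)) has_derivative
      (\<lambda>h. inverse (norm (W p)) *\<^sub>R W' h + k h *\<^sub>R W p)) (at p)"
    using sgn_has_derivative[OF assms] by blast
  from frechet_derivative_at[OF this, symmetric] show ?thesis
    unfolding pullback_area_def
    by (simp only: sgn_div_norm area_form_scale_shear) (simp add: field_simps)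
qed

lemma bilinear_pullback_area:
  assumes "\<phi> differentiable (at p)"
  shows "bilinear (pullback_area \<phi> p)" "pullback_area \<phi> p u v = - pullback_area \<phi> p v u"
proof -
  have l: "linear (frechet_derivative \<phi> (at p))"
    by (rule linear_frechet_derivative[OF assms])
  show "bilinear (pullback_area \<phi> p)"
    unfolding bilinear_def pullback_area_def area_form_def
    by (intro conjI allI linearI)
      (simp_all add: linear_add[OF l] linear_scale[OF l] split_beta algebra_simps)
  show "pullback_area \<phi> p u v = - pullback_area \<phi> p v u"
    by (simp add: pullback_area_def area_form_def split_beta algebra_simps)
qed


section \<open>Curl eigenforms and their invariants\<close>

text \<open>The substitution \<open>u = (sin s)\<^sup>2\<close> absorbs the density
  \<open>cos s * sin s\<close> up to a factor 1/2, and the two angles contribute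
  \<open>4 * pi\<^sup>2\<close>.\<close>

lemma S3_integral_rho:
  assumes \<omega>: "\<And>z. z \<in> S3 \<Longrightarrow> \<omega> z (frame_R z) (frame_X1 z) (frame_X2 z) = c * C' (rho z)"
    and C: "\<And>u. (C has_real_derivative C' u) (at u)" "continuous_on UNIV C'"
  shows "S3_integral \<omega> = 2 * pi\<^sup>2 * c * (C 1 - C 0)"
proof -
  define G where "G s = c * C' ((sin s)\<^sup>2) * (cos s * sin s)" for s
  have S3: "hopf_param (s, a, b) \<in> S3" and rho: "rho (hopf_param (s, a, b)) = (sin s)\<^sup>2" for s a b
    by (simp_all add: hopf_param_def norm_Pair norm_mult rho_def power_mult_distrib
        flip: distrib_left)
  have cont: "continuous_on T (\<lambda>x. G (fst x))" for T :: "(real \<times> real \<times> real) set"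
    unfolding G_def by (intro continuous_intros continuous_on_compose2[OF C(2)]) auto
  have "S3_integral \<omega> = integral (cbox (0, 0, 0) (pi / 2, 2 * pi, 2 * pi)) (\<lambda>x. G (fst x))"
    unfolding S3_integral_def Let_def split_beta
    by (rule integral_cong) (simp add: \<omega>[OF S3] rho G_def split_beta flip: prod.collapse)
  also have "\<dots> = integral (cbox 0 (pi / 2))
      (\<lambda>s. integral (cbox (0, 0) (2 * pi, 2 * pi)) (\<lambda>y::real \<times> real. G s))"
    using integral_prod_continuous[of "0::real" "(0, 0)::real \<times> real" "pi / 2" "(2 * pi, 2 * pi)"
        "\<lambda>x. G (fst x)"] cont by simp
  also have "\<dots> = 4 * pi\<^sup>2 * integral {0..pi / 2} G"
    by (simp add: content_Pair power2_eq_square)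
  also have "integral {0..pi / 2} G = c / 2 * C ((sin (pi / 2))\<^sup>2) - c / 2 * C ((sin 0)\<^sup>2)"
  proof (intro integral_unique fundamental_theorem_of_calculus)
    fix s assume "s \<in> {0..pi / 2}"
    have "((\<lambda>s. C ((sin s)\<^sup>2)) has_real_derivative C' ((sin s)\<^sup>2) * (2 * sin s * cos s)) (at s)"
      by (rule DERIV_chain2[OF C(1)]) (auto intro!: derivative_eq_intros)
    from DERIV_cmult[OF this, of "c / 2"]
    have "((\<lambda>s. c / 2 * C ((sin s)\<^sup>2)) has_real_derivative G s) (at s)"
      by (simp add: G_def mult_ac)
    then show "((\<lambda>s. c / 2 * C ((sin s)\<^sup>2)) has_vector_derivative G s) (at s within {0..pi / 2})"
      by (simp add: has_real_derivative_iff_has_vector_derivative has_vector_derivative_at_within)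
  qed simp
  finally show ?thesis
    by (simp add: algebra_simps)
qed

text \<open>For \<open>A = (1 - u) a\<close> and \<open>B = u b\<close> the two curl equations read
  \<open>A' = - n b\<close> and \<open>B' = n a\<close>: the system above with the factors
  \<open>u\<close> and \<open>1 - u\<close> cancelled.\<close>

locale torus_eigenform =
  fixes a b :: "real \<Rightarrow> real" and n :: real
  assumes smooth_a: "smooth_on UNIV a" and smooth_b: "smooth_on UNIV b"
    and n_pos: "n > 0"
    and curl_a: "\<And>u. (1 - u) * deriv a u - a u = - n * b u"
    and curl_b: "\<And>u. b u + u * deriv b u = n * a u"
    and nonvanishing: "\<And>u. (1 - u) * (a u)\<^sup>2 + u * (b u)\<^sup>2 > 0"
begin

text \<open>The squared norm of the form in the round metric, on the torus
  \<open>rho z = u\<close>.\<close>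

definition N :: "real \<Rightarrow> real" where
  "N u = (1 - u) * (a u)\<^sup>2 + u * (b u)\<^sup>2"

text \<open>The first component of the Gauss map.\<close>

definition C :: "real \<Rightarrow> real" where
  "C u = ((1 - u) * a u + u * b u) / sqrt (N u)"

text \<open>The metric dual of the form divided by its squared norm; the two vectors are the
  rotation fields of the two angles.\<close>

definition reeb :: "C2 \<Rightarrow> C2" where
  "reeb z = (1 / N (rho z)) *\<^sub>R
     (a (rho z) *\<^sub>R (\<i> * fst z, 0) + b (rho z) *\<^sub>R (0, \<i> * snd z))"

definition W :: "C2 \<Rightarrow> real \<times> real \<times> real" where
  "W z = (torus_form a b z (frame_R z), torus_form a b z (frame_X1 z), torus_form a b z (frame_X2 z))"

lemma N_pos: "N u > 0"
  using nonvanishing by (simp add: N_def)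

lemmas deriv_a = has_deriv_smooth[OF smooth_a]
lemmas deriv_b = has_deriv_smooth[OF smooth_b]

section \<open>Curl equation, contact condition and compatibility\<close>

lemma ext_deriv_frame:
  assumes "z \<in> S3"
  shows "ext_deriv (torus_form a b) z (frame_X1 z) (frame_X2 z) = 2 * n * torus_form a b z (frame_R z)"
    "ext_deriv (torus_form a b) z (frame_X2 z) (frame_R z) = 2 * n * torus_form a b z (frame_X1 z)"
    "ext_deriv (torus_form a b) z (frame_R z) (frame_X1 z) = 2 * n * torus_form a b z (frame_X2 z)"
  unfolding ext_deriv_torus_form_frame[OF assms deriv_a deriv_b refl refl] torus_form_frame[OF assms]
    curl_a curl_b
  by (simp_all add: algebra_simps)

lemma sum_squares_frame:
  assumes "z \<in> S3"
  shows "(torus_form a b z (frame_R z))\<^sup>2 + (torus_form a b z (frame_X1 z))\<^sup>2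
    + (torus_form a b z (frame_X2 z))\<^sup>2 = N (rho z)"
proof -
  have "(torus_form a b z (frame_R z))\<^sup>2 + (torus_form a b z (frame_X1 z))\<^sup>2
      + (torus_form a b z (frame_X2 z))\<^sup>2
    = ((1 - rho z) * a (rho z) + rho z * b (rho z))\<^sup>2 + (a (rho z) - b (rho z))\<^sup>2
        * ((Re (fst z * snd z))\<^sup>2 + (Im (fst z * snd z))\<^sup>2)"
    unfolding torus_form_frame[OF assms]
    by (simp add: power2_eq_square algebra_simps del: times_complex.simps)
  also have "\<dots> = N (rho z)"
    unfolding norm_fst_times_snd[OF assms] N_def by (simp add: power2_eq_square algebra_simps)
  finally show ?thesis .
qed

lemma contact: "contact_form (torus_form a b)"
proof -
  have "wedge12 (torus_form a b z) (ext_deriv (torus_form a b) z)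
      (frame_R z) (frame_X1 z) (frame_X2 z) = 2 * n * N (rho z)" if "z \<in> S3" for z
    unfolding wedge12_def ext_deriv_frame[OF that] sum_squares_frame[OF that, symmetric]
    by (simp add: power2_eq_square algebra_simps)
  then show ?thesis
    unfolding contact_form_def using n_pos N_pos smooth_torus_form[OF smooth_a smooth_b]
    by (auto simp: less_imp_neq[THEN not_sym])
qed

lemma weakly_compatible: "weakly_compatible round_metric (torus_form a b)"
proof -
  have "is_hodge_star round_metric z (ext_deriv (torus_form a b) z)
      (\<lambda>v. 2 * n * torus_form a b z v)" if "z \<in> S3" for z
    using that ext_deriv_frame[OF that] linear_torus_form[of a b z]
    by (intro is_hodge_star_roundI bilinear_ext_deriv_torus_form smooth_a smooth_b
        ext_deriv_alternating linearI) (auto simp: linear_add linear_scale algebra_simps)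
  moreover have "smooth_near_S3 (\<lambda>z. 2 * n)"
    unfolding smooth_near_S3_def using smooth_on_const open_UNIV by blast
  ultimately show ?thesis
    unfolding weakly_compatible_def using riemannian_round n_pos
    by (intro conjI exI[of _ "\<lambda>z. 2 * n"]) auto
qed

section \<open>The Reeb field and its Gauss map\<close>

lemma inner_reeb: "reeb z \<bullet> v = torus_form a b z v / N (rho z)"
  by (simp add: reeb_def inner_C2 torus_form_def ang_def add_divide_distrib diff_divide_distrib
      algebra_simps)

lemma reeb: "reeb_field (torus_form a b) reeb"
  unfolding reeb_field_def smooth_vector_field_def smooth_near_S3_def
proof (intro conjI exI[of _ UNIV] ballI)
  have "bounded_linear (\<lambda>z::C2. (\<i> * fst z, 0 :: complex))"
    "bounded_linear (\<lambda>z::C2. (0 :: complex, \<i> * snd z))"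
    by (intro bounded_linear_Pair bounded_linear_zero
        bounded_linear_compose[OF bounded_linear_mult_right] bounded_linear_fst bounded_linear_snd)+
  moreover have N: "smooth_on UNIV (\<lambda>z. 1 / N (rho z))"
    using N_pos unfolding N_def
    by (intro smooth_on_intros smooth_on_rho smooth_on_compose_rho smooth_a smooth_b)
      (auto simp: less_imp_neq[THEN not_sym])
  ultimately show "smooth_on UNIV reeb"
    unfolding reeb_def [abs_def]
    by (intro smooth_on_scaleR[OF open_UNIV N] smooth_on_scaleR[OF open_UNIV] smooth_on_add[OF open_UNIV]
        smooth_on_compose_rho[OF smooth_a] smooth_on_compose_rho[OF smooth_b]
        smooth_on_bounded_linear) auto
next
  fix z :: C2 assume z: "z \<in> S3"
  show tangent: "reeb z \<in> tangent_S3 z"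
    by (simp add: tangent_S3_def inner_reeb torus_form_def ang_def)
  have "torus_form a b z (reeb z) =
      (torus_form a b z (frame_R z))\<^sup>2 / N (rho z) + (torus_form a b z (frame_X1 z))\<^sup>2 / N (rho z)
    + (torus_form a b z (frame_X2 z))\<^sup>2 / N (rho z)"
    by (simp add: linear_frame[OF linear_torus_form z tangent] inner_reeb power2_eq_square)
  then show "torus_form a b z (reeb z) = 1"
    using sum_squares_frame[OF z] N_pos[of "rho z"] by (simp flip: add_divide_distrib)
  fix v assume "v \<in> tangent_S3 z"
  \<comment> \<open>By the curl equation the frame components of the 2-form are proportional to
    those of \<open>reeb z\<close>, so the expansion is a determinant with two proportional
    rows.\<close>
  from alternating_frame[of "ext_deriv (torus_form a b) z", OF
      bilinear_ext_deriv_torus_form[OF smooth_a smooth_b] ext_deriv_alternating z tangent this]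
  show "ext_deriv (torus_form a b) z (reeb z) v = 0"
    unfolding ext_deriv_frame[OF z] inner_reeb by (simp add: algebra_simps)
qed auto

lemma gauss_map_reeb: "gauss_map reeb = (\<lambda>z. sgn (W z))"
proof
  fix z
  have "gauss_map reeb z = sgn (inverse (N (rho z)) *\<^sub>R W z)"
    by (simp add: gauss_map_def W_def inner_reeb field_simps)
  also have "\<dots> = sgn (W z)"
    using N_pos[of "rho z"] by (simp add: sgn_scaleR)
  finally show "gauss_map reeb z = sgn (W z)" .
qed

lemma norm_W: "z \<in> S3 \<Longrightarrow> norm (W z) = sqrt (N (rho z))"
  using sum_squares_frame[of z] by (simp add: W_def norm_Pair add.assoc)

text \<open>\<open>W\<close> is differentiated in the ambient space, so
  \<open>fst z \<bullet> fst z\<close> appears where \<open>1 - u\<close> would be right only on the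
  sphere.\<close>

definition dW :: "C2 \<Rightarrow> C2 \<Rightarrow> real \<times> real \<times> real" where
  "dW z h = (let u = rho z; du = 2 * (snd z \<bullet> snd h); \<zeta> = fst z * snd z;
       d\<zeta> = fst h * snd z + fst z * snd h in
     (deriv a u * du * (fst z \<bullet> fst z) + 2 * a u * (fst z \<bullet> fst h) + deriv b u * du * u + b u * du,
      (deriv a u - deriv b u) * du * Im \<zeta> + (a u - b u) * Im d\<zeta>,
      (deriv b u - deriv a u) * du * Re \<zeta> + (b u - a u) * Re d\<zeta>))"

lemma W_has_derivative: "(W has_derivative dW z) (at z)"
proof -
  note [derivative_intros] =
    deriv_a[unfolded has_field_derivative_def, THEN has_derivative_compose[OF rho_has_derivative]]
    deriv_b[unfolded has_field_derivative_def, THEN has_derivative_compose[OF rho_has_derivative]]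
  have W: "W = (\<lambda>z. (a (rho z) * (fst z \<bullet> fst z) + b (rho z) * rho z,
      (a (rho z) - b (rho z)) * Im (fst z * snd z), (b (rho z) - a (rho z)) * Re (fst z * snd z)))"
    by (auto simp: W_def torus_form_def ang_def rho_def inner_complex_def power2_eq_square algebra_simps)
  show ?thesis
    unfolding W
    by (auto intro!: derivative_eq_intros simp del: times_complex.simps
        simp: dW_def Let_def fun_eq_iff inner_commute algebra_simps)
qed

text \<open>The numerator of \<open>C'\<close> over \<open>sqrt N ^ 3\<close>. With
  \<open>f = (1 - u) a + u b\<close>, \<open>g = b - a\<close> and
  \<open>N = f\<^sup>2 + g\<^sup>2 u (1 - u)\<close> it is \<open>f' N - f N' / 2\<close>, in which
  the terms \<open>f\<^sup>2 f'\<close> cancel; \<open>f' = n (a - b)\<close> by the curl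
  equations.\<close>

definition J :: "real \<Rightarrow> real" where
  "J u = n * (a u - b u) * (b u - a u)\<^sup>2 * (u * (1 - u))
     - ((1 - u) * a u + u * b u) * (b u - a u)
       * ((deriv b u - deriv a u) * (u * (1 - u)) + (b u - a u) * (1 - 2 * u) / 2)"

lemma C_has_derivative: "(C has_real_derivative J u / sqrt (N u) ^ 3) (at u)"
proof -
  define f where "f u = (1 - u) * a u + u * b u" for u
  define g where "g u = b u - a u" for u
  have N: "N = (\<lambda>u. (f u)\<^sup>2 + (g u)\<^sup>2 * (u * (1 - u)))"
    by (auto simp: N_def f_def g_def power2_eq_square algebra_simps)
  have "(f has_real_derivative (1 - u) * deriv a u - a u + (b u + u * deriv b u)) (at u)"
    unfolding f_def by (auto intro!: derivative_eq_intros deriv_a deriv_b)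
  then have f': "(f has_real_derivative n * (a u - b u)) (at u)"
    unfolding curl_a curl_b by (simp add: algebra_simps)
  define g' where "g' = deriv b u - deriv a u"
  have g': "(g has_real_derivative g') (at u)"
    unfolding g_def g'_def by (auto intro!: derivative_eq_intros deriv_a deriv_b)
  define N' where "N' = 2 * f u * (n * (a u - b u)) + 2 * g u * g' * (u * (1 - u)) + (g u)\<^sup>2 * (1 - 2 * u)"
  have N': "(N has_real_derivative N') (at u)"
    unfolding N N'_def by (auto intro!: derivative_eq_intros f' g' simp: algebra_simps)
  have "((\<lambda>u. f u / sqrt (N u)) has_real_derivative
      (n * (a u - b u) * sqrt (N u) - f u * (N' / (2 * sqrt (N u)))) / (sqrt (N u) * sqrt (N u))) (at u)"
    using N_pos[of u] by (auto intro!: derivative_eq_intros f' N' simp: field_simps)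
  also have "(n * (a u - b u) * sqrt (N u) - f u * (N' / (2 * sqrt (N u)))) / (sqrt (N u) * sqrt (N u))
    = (n * (a u - b u) * N u - f u * N' / 2) / sqrt (N u) ^ 3"
    using N_pos[of u] by (simp add: field_simps power3_eq_cube)
  also have "n * (a u - b u) * N u - f u * N' / 2 = J u"
    unfolding J_def N N'_def f_def[symmetric] g_def[symmetric] g'_def[symmetric]
    by (simp add: power2_eq_square field_simps)
  finally show ?thesis
    by (simp add: C_def [abs_def] f_def)
qed

text \<open>Along the frame, \<open>u\<close> has derivatives \<open>0\<close>, \<open>2 x\<close>,
  \<open>2 y\<close>, and the product \<open>x + \<i> y\<close> of the two coordinates has
  derivatives \<open>2 \<i> (x + \<i> y)\<close>, \<open>1 - 2 u\<close>,
  \<open>\<i> (1 - 2 u)\<close>.\<close>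

lemma dW_frame:
  fixes z defines "u \<equiv> rho z" and "x \<equiv> Re (fst z * snd z)" and "y \<equiv> Im (fst z * snd z)"
    and "g \<equiv> b (rho z) - a (rho z)" and "g' \<equiv> deriv b (rho z) - deriv a (rho z)"
  assumes z: "z \<in> S3"
  shows "W z = ((1 - u) * a u + u * b u, - g * y, g * x)"
    "dW z (frame_R z) = (0, - 2 * g * x, - 2 * g * y)"
    "dW z (frame_X1 z) = (- 2 * n * g * x, - 2 * g' * x * y, 2 * g' * x\<^sup>2 + g * (1 - 2 * u))"
    "dW z (frame_X2 z) = (- 2 * n * g * y, - 2 * g' * y\<^sup>2 - g * (1 - 2 * u), 2 * g' * x * y)"
proof -
  show "W z = ((1 - u) * a u + u * b u, - g * y, g * x)"
    unfolding W_def torus_form_frame[OF z] by (simp add: u_def x_def y_def g_def algebra_simps)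
  have s: "fst z \<bullet> fst z = 1 - u" and s': "Re (fst z) * Re (fst z) + Im (fst z) * Im (fst z) = 1 - u"
    using one_minus_rho[OF z] by (simp_all add: u_def inner_complex_def power2_eq_square)
  have r: "Re (snd z) * Re (snd z) + Im (snd z) * Im (snd z) = u"
    by (simp add: u_def rho_def power2_eq_square)
  have f': "- n * g = (1 - u) * deriv a u - a u + (b u + u * deriv b u)"
    unfolding curl_a curl_b by (simp add: g_def u_def algebra_simps)
  show "dW z (frame_R z) = (0, - 2 * g * x, - 2 * g * y)"
    by (simp add: dW_def Let_def inner_complex_def x_def y_def g_def algebra_simps)
  have 1: "snd z \<bullet> snd (frame_X1 z) = x" "fst z \<bullet> fst (frame_X1 z) = - x"
    "snd z \<bullet> snd (frame_X2 z) = y" "fst z \<bullet> fst (frame_X2 z) = - y"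
    by (simp_all add: x_def y_def inner_complex_def algebra_simps)
  have 2: "fst (frame_X1 z) * snd z + fst z * snd (frame_X1 z) = of_real (1 - 2 * u)"
    "fst (frame_X2 z) * snd z + fst z * snd (frame_X2 z) = \<i> * of_real (1 - 2 * u)"
    using s' r by (simp_all add: complex_eq_iff algebra_simps)
  show "dW z (frame_X1 z) = (- 2 * n * g * x, - 2 * g' * x * y, 2 * g' * x\<^sup>2 + g * (1 - 2 * u))"
    using f' unfolding dW_def Let_def 1 2 s u_def[symmetric] x_def[symmetric] y_def[symmetric]
    by (simp add: g_def g'_def u_def power2_eq_square) algebra
  show "dW z (frame_X2 z) = (- 2 * n * g * y, - 2 * g' * y\<^sup>2 - g * (1 - 2 * u), 2 * g' * x * y)"
    using f' unfolding dW_def Let_def 1 2 s u_def[symmetric] x_def[symmetric] y_def[symmetric]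
    by (simp add: g_def g'_def u_def power2_eq_square) algebra
qed

text \<open>These are the frame values of
  \<open>- dC \<and> (d\<theta>\<^sub>1 + d\<theta>\<^sub>2)\<close>, with \<open>c\<close> the
  derivative of \<open>C\<close> at \<open>rho z\<close>.\<close>

lemma pullback_area_frame:
  assumes z: "z \<in> S3" and J: "c = J (rho z) / sqrt (N (rho z)) ^ 3"
  shows "pullback_area (gauss_map reeb) z (frame_X1 z) (frame_X2 z) = - 2 * (1 - 2 * rho z) * c"
    "pullback_area (gauss_map reeb) z (frame_X2 z) (frame_R z) = - 4 * Im (fst z * snd z) * c"
    "pullback_area (gauss_map reeb) z (frame_R z) (frame_X1 z) = 4 * Re (fst z * snd z) * c"
proof -
  have nz: "W z \<noteq> 0"
    using norm_W[OF z] N_pos[of "rho z"] by auto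
  define x where "x = Re (fst z * snd z)"
  define y where "y = Im (fst z * snd z)"
  have xy: "rho z * (1 - rho z) = x\<^sup>2 + y\<^sup>2"
    using norm_fst_times_snd[OF z] by (simp add: x_def y_def)
  note pull = pullback_area_sgn[OF W_has_derivative nz] gauss_map_reeb norm_W[OF z]
  note frame = dW_frame[OF z] x_def[symmetric] y_def[symmetric]
  have "area_form (W z) (dW z (frame_X1 z)) (dW z (frame_X2 z)) = - 2 * (1 - 2 * rho z) * J (rho z)"
    unfolding frame J_def xy area_form_def prod.case
    by (simp add: power2_eq_square field_simps)
  then show "pullback_area (gauss_map reeb) z (frame_X1 z) (frame_X2 z) = - 2 * (1 - 2 * rho z) * c"
    unfolding pull J by simp
  have "area_form (W z) (dW z (frame_X2 z)) (dW z (frame_R z)) = - 4 * y * J (rho z)"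
    unfolding frame J_def xy area_form_def prod.case
    by (simp add: power2_eq_square field_simps)
  then show "pullback_area (gauss_map reeb) z (frame_X2 z) (frame_R z) = - 4 * Im (fst z * snd z) * c"
    unfolding pull J y_def by simp
  have "area_form (W z) (dW z (frame_R z)) (dW z (frame_X1 z)) = 4 * x * J (rho z)"
    unfolding frame J_def xy area_form_def prod.case
    by (simp add: power2_eq_square field_simps)
  then show "pullback_area (gauss_map reeb) z (frame_R z) (frame_X1 z) = 4 * Re (fst z * snd z) * c"
    unfolding pull J x_def by simp
qed

text \<open>
  The primitive of the pulled back area form is \<open>(\<kappa> - C) d\<theta>\<^sub>1 + (1 - C) d\<theta>\<^sub>2\<close> in polar coordinates,
  which extends smoothly to the core circles thanks to \<open>C 0 = 1\<close> and \<open>C 1 = \<kappa>\<close>.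
\<close>

lemma hopf_invariant:
  assumes p: "smooth_on UNIV p" and q: "smooth_on UNIV q"
    and pC: "\<And>u. (1 - u) * p u = \<kappa> - C u" and qC: "\<And>u. u * q u = 1 - C u"
  shows "has_hopf_invariant (torus_form a b) (- ((\<kappa> - 1) / 2)\<^sup>2)"
proof -
  define C' where "C' u = J u / sqrt (N u) ^ 3" for u
  note C' = C_has_derivative[folded C'_def]
  \<comment> \<open>Both angular coefficients of the primitive have derivative \<open>- C'\<close>,
    which turns the frame values of its exterior derivative into those of the pulled back area
    form.\<close>
  have P': "- C' u = (1 - u) * deriv p u - p u" for u
  proof (rule DERIV_unique)
    show "((\<lambda>u. (1 - u) * p u) has_real_derivative (1 - u) * deriv p u - p u) (at u)"
      by (auto intro!: derivative_eq_intros has_deriv_smooth[OF p])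
    show "((\<lambda>u. (1 - u) * p u) has_real_derivative - C' u) (at u)"
      unfolding pC by (auto intro!: derivative_eq_intros C')
  qed
  have Q': "- C' u = q u + u * deriv q u" for u
  proof (rule DERIV_unique)
    show "((\<lambda>u. u * q u) has_real_derivative q u + u * deriv q u) (at u)"
      by (auto intro!: derivative_eq_intros has_deriv_smooth[OF q])
    show "((\<lambda>u. u * q u) has_real_derivative - C' u) (at u)"
      unfolding qC by (auto intro!: derivative_eq_intros C')
  qed
  have cont: "continuous_on UNIV C'"
  proof -
    have "C' = (\<lambda>u. - (q u + u * deriv q u))"
      by (rule ext) (simp flip: Q')
    moreover have "continuous_on UNIV q"
      using has_deriv_smooth[OF q] by (meson DERIV_continuous_on has_field_derivative_at_within)
    ultimately show ?thesis
      by (auto intro!: continuous_intros continuous_on_deriv_smooth[OF q])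
  qed
  note d = ext_deriv_torus_form_frame[OF _ has_deriv_smooth[OF p] has_deriv_smooth[OF q] P' Q']
  have prim: "ext_deriv (torus_form p q) z v w = pullback_area (gauss_map reeb) z v w"
    if z: "z \<in> S3" and vw: "v \<in> tangent_S3 z" "w \<in> tangent_S3 z" for z v w
  proof -
    have "W z \<noteq> 0"
      using norm_W[OF z] N_pos[of "rho z"] by auto
    then have diff: "gauss_map reeb differentiable (at z)"
      unfolding gauss_map_reeb differentiable_def
      using sgn_has_derivative[OF W_has_derivative] by blast
    show ?thesis
      unfolding alternating_frame[of "ext_deriv (torus_form p q) z", OF
          bilinear_ext_deriv_torus_form[OF p q] ext_deriv_alternating z vw]
        alternating_frame[OF bilinear_pullback_area[OF diff] z vw]
        d[OF z] pullback_area_frame[OF z C'_def]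
      by (simp add: algebra_simps)
  qed
  have "wedge12 (torus_form p q z) (ext_deriv (torus_form p q) z) (frame_R z) (frame_X1 z) (frame_X2 z)
      = 2 * (1 - \<kappa>) * C' (rho z)" if z: "z \<in> S3" for z
  proof -
    define u x y where "u = rho z" and "x = Re (fst z * snd z)" and "y = Im (fst z * snd z)"
    have xy: "x\<^sup>2 + y\<^sup>2 = u * (1 - u)"
      using norm_fst_times_snd[OF z] by (simp add: u_def x_def y_def)
    have "wedge12 (torus_form p q z) (ext_deriv (torus_form p q) z) (frame_R z) (frame_X1 z) (frame_X2 z)
      = - 2 * C' u * (((1 - u) * p u + u * q u) * (1 - 2 * u) + 2 * (p u - q u) * (x\<^sup>2 + y\<^sup>2))"
      unfolding wedge12_def d[OF z] torus_form_frame[OF z]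
        u_def[symmetric] x_def[symmetric] y_def[symmetric]
      by (simp add: power2_eq_square algebra_simps)
    also have "\<dots> = - 2 * C' u * ((1 - u) * p u - u * q u)"
      unfolding xy by (simp add: algebra_simps)
    \<comment> \<open>\<open>C\<close> cancels in \<open>(\<kappa> - C) - (1 - C)\<close>, leaving a
      constant times \<open>C'\<close>, so the integral sees only the boundary values of
      \<open>C\<close>.\<close>
    also have "\<dots> = 2 * (1 - \<kappa>) * C' (rho z)"
      unfolding pC qC u_def by (simp add: algebra_simps)
    finally show ?thesis .
  qed
  from S3_integral_rho[of "\<lambda>z. wedge12 (torus_form p q z) (ext_deriv (torus_form p q) z)", OF this C' cont]
  have "S3_integral (\<lambda>z. wedge12 (torus_form p q z) (ext_deriv (torus_form p q) z))
      = 4 * pi\<^sup>2 * (1 - \<kappa>) * (C 1 - C 0)"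
    by simp
  \<comment> \<open>The factor \<open>1 - u\<close> vanishes at 1 and \<open>u\<close> vanishes at
    0, which forces \<open>C 1 = \<kappa>\<close> and \<open>C 0 = 1\<close>.\<close>
  also have "C 1 - C 0 = \<kappa> - 1"
    using pC[of 1] qC[of 0] by simp
  finally have "- ((\<kappa> - 1) / 2)\<^sup>2
      = 1 / (16 * pi\<^sup>2) * S3_integral (\<lambda>z. wedge12 (torus_form p q z) (ext_deriv (torus_form p q) z))"
    by (simp add: power2_eq_square field_simps)
  then show ?thesis
    unfolding has_hopf_invariant_def using reeb smooth_torus_form[OF p q] prim by blast
qed

end

text \<open>On the torus \<open>rho z = c\<close> the form is a nonzero multiple of
  \<open>d\<theta>\<^sub>1\<close>. It therefore vanishes on the disk where the first coordinate is
  a positive real and \<open>rho z \<le> c\<close>, whose boundary lies on that torus.\<close>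

lemma (in torus_eigenform) overtwisted:
  assumes c: "0 < c" "c < 1" and bc: "b c = 0"
  shows "overtwisted (contact_planes (torus_form a b))"
proof -
  define F :: "complex \<Rightarrow> C2" where
    "F w = sqrt (1 - c * ((Re w)\<^sup>2 + (Im w)\<^sup>2)) *\<^sub>R (1, 0) + sqrt c *\<^sub>R (0, w)" for w
  define D where "D = {w. c * ((Re w)\<^sup>2 + (Im w)\<^sup>2) < 1}"
  have D: "open D"
    unfolding D_def by (intro open_Collect_less continuous_intros)
  have disk: "c * ((Re w)\<^sup>2 + (Im w)\<^sup>2) < 1" if "w \<in> cball 0 1" for w
  proof -
    have "(Re w)\<^sup>2 + (Im w)\<^sup>2 \<le> 1"
      using that by (simp add: cmod_def)
    then have "c * ((Re w)\<^sup>2 + (Im w)\<^sup>2) \<le> c"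
      using mult_left_le[of "(Re w)\<^sup>2 + (Im w)\<^sup>2" c] c by (simp del: distrib_left)
    with c show ?thesis by linarith
  qed
  have F_sel: "Re (fst (F w)) = sqrt (1 - c * ((Re w)\<^sup>2 + (Im w)\<^sup>2))" "Im (fst (F w)) = 0"
    "snd (F w) = sqrt c *\<^sub>R w" for w
    by (simp_all add: F_def)
  have smooth: "smooth_on D F"
    unfolding F_def [abs_def]
    by (intro smooth_on_intros smooth_on_bounded_linear D bounded_linear_Re bounded_linear_Im
        bounded_linear_Pair bounded_linear_zero bounded_linear_ident) (simp add: D_def)
  define dF :: "complex \<Rightarrow> complex \<Rightarrow> C2" where
    "dF w h = (- c * (w \<bullet> h) / sqrt (1 - c * ((Re w)\<^sup>2 + (Im w)\<^sup>2))) *\<^sub>R (1, 0) + sqrt c *\<^sub>R (0, h)" for w h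
  have "(F has_derivative dF w) (at w)" if "w \<in> cball 0 1" for w
    unfolding F_def [abs_def] dF_def [abs_def] using disk[OF that]
    by (auto intro!: derivative_eq_intros simp: fun_eq_iff inner_complex_def field_simps)
  then have F': "frechet_derivative F (at w) = dF w" if "w \<in> cball 0 1" for w
    using frechet_derivative_at that by metis
  have S3: "F w \<in> S3" if "w \<in> cball 0 1" for w
    unfolding mem_S3_iff F_sel using disk[OF that] c
    by (simp add: power_mult_distrib flip: distrib_left)
  have "embedded_disk F"
    unfolding embedded_disk_def
  proof (intro conjI)
    show "\<exists>D. open D \<and> cball 0 1 \<subseteq> D \<and> smooth_on D F"
      using D smooth disk by (auto simp: D_def simp del: mem_cball_0)
    show "inj_on F (cball 0 1)"
    proof (rule inj_onI)
      fix v w assume "F v = F w"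
      then have "sqrt c *\<^sub>R v = sqrt c *\<^sub>R w"
        by (metis F_sel(3))
      with c show "v = w" by simp
    qed
    show "\<forall>w\<in>cball 0 1. inj (frechet_derivative F (at w))"
      using c by (auto simp: F' dF_def inj_def)
  qed (use S3 in blast)
  moreover have "range (frechet_derivative F (at w)) = contact_planes (torus_form a b) (F w)"
    if w: "w \<in> sphere 0 1" for w
  proof -
    have norm: "(Re w)\<^sup>2 + (Im w)\<^sup>2 = 1"
      using w by (simp add: cmod_def)
    have rho: "rho (F w) = c"
      unfolding rho_def F_sel using c norm by (simp add: power_mult_distrib flip: distrib_left)
    have "a c \<noteq> 0"
      using nonvanishing[of c] bc by auto
    then have plane: "contact_planes (torus_form a b) (F w)
        = {v. v \<bullet> F w = 0 \<and> Im (fst v) = 0}"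
      using c by (auto simp: contact_planes_def tangent_S3_def torus_form_def rho bc ang_def F_sel norm)
    have "dF w h \<in> contact_planes (torus_form a b) (F w)" for h
    proof -
      have "Re (fst (dF w h)) = - c * (w \<bullet> h) / sqrt (1 - c)" "snd (dF w h) = sqrt c *\<^sub>R h"
        by (simp_all add: dF_def norm)
      then have "dF w h \<bullet> F w = - c * (w \<bullet> h) + sqrt c * (sqrt c * (w \<bullet> h))"
        using c by (simp add: inner_prod_def inner_complex_def[of "fst (dF w h)"] F_sel norm
            inner_commute[of h] del: real_sqrt_mult_self)
      also have "\<dots> = 0"
        using c by (simp flip: mult.assoc)
      finally show ?thesis
        by (simp add: plane) (simp add: dF_def)
    qed
    \<comment> \<open>A vector in the contact plane is determined by its second component: its first
      component is real, and tangency to the sphere fixes that real part.\<close>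
    moreover have "v = dF w ((1 / sqrt c) *\<^sub>R snd v)"
      if "v \<in> contact_planes (torus_form a b) (F w)" for v
    proof -
      have "v \<bullet> F w = 0" "Im (fst v) = 0"
        using that by (auto simp: plane)
      then have "Re (fst v) * sqrt (1 - c) + sqrt c * (snd v \<bullet> w) = 0"
        by (simp add: inner_prod_def inner_complex_def[of "fst v"] F_sel norm)
      then have "Re (fst v) = - sqrt c * (snd v \<bullet> w) / sqrt (1 - c)"
        using c by (simp add: field_simps)
      moreover have "c * (w \<bullet> ((1 / sqrt c) *\<^sub>R snd v)) = c / sqrt c * (snd v \<bullet> w)"
        by (simp add: inner_commute)
      ultimately have "Re (fst v) = - c * (w \<bullet> ((1 / sqrt c) *\<^sub>R snd v)) / sqrt (1 - c)"
        using c by (simp only: real_div_sqrt) simp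
      with \<open>Im (fst v) = 0\<close> c show ?thesis
        unfolding dF_def norm by (simp add: C2_eq_iff)
    qed
    ultimately have "range (dF w) = contact_planes (torus_form a b) (F w)"
      by blast
    with w F' show ?thesis by simp
  qed
  ultimately show ?thesis
    unfolding overtwisted_def by blast
qed


section \<open>The eigenforms for the eigenvalues 4 and 6\<close>

lemma smooth_on_ident: "smooth_on S (\<lambda>u::real. u)"
  by (rule smooth_on_bounded_linear[OF bounded_linear_ident])

text \<open>Eliminating \<open>b\<close> leaves a hypergeometric equation for
  \<open>(1 - u) a\<close>, solved by the terminating series \<open>F(- n, n; 1; u)\<close>. For
  \<open>n = 2\<close> it is \<open>1 - 4 u + 3 u\<^sup>2\<close>.\<close>

lemma torus_eigenform_eigenvalue_4: "torus_eigenform (\<lambda>u. 1 - 3 * u) (\<lambda>u. 2 - 3 * u) 2"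
proof
  have d: "deriv (\<lambda>u::real. 1 - 3 * u) u = - 3" "deriv (\<lambda>u::real. 2 - 3 * u) u = - 3" for u
    by (auto intro!: DERIV_imp_deriv derivative_eq_intros)
  show "(1 - u) * deriv (\<lambda>u. 1 - 3 * u) u - (1 - 3 * u) = - 2 * (2 - 3 * u)"
    "2 - 3 * u + u * deriv (\<lambda>u. 2 - 3 * u) u = 2 * (1 - 3 * u)" for u :: real
    unfolding d by (simp_all add: algebra_simps)
  show "(1 - u) * (1 - 3 * u)\<^sup>2 + u * (2 - 3 * u)\<^sup>2 > 0" for u :: real
  proof -
    have "(1 - u) * (1 - 3 * u)\<^sup>2 + u * (2 - 3 * u)\<^sup>2 = 3 * (u - 1 / 2)\<^sup>2 + 1 / 4"
      by (simp add: power2_eq_square field_simps)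
    also have "\<dots> > 0"
      by (intro add_nonneg_pos) auto
    finally show ?thesis .
  qed
  show "(2::real) > 0" by simp
qed (intro smooth_on_intros smooth_on_ident open_UNIV)+

text \<open>Here \<open>(1 - u) a\<close> is \<open>F(- 3, 3; 1; u)\<close>. The squared norm is
  quadratic in \<open>u (1 - u)\<close>, and completing the square shows that it is
  positive.\<close>

lemma torus_eigenform_eigenvalue_6:
  "torus_eigenform (\<lambda>u. 1 - 8 * u + 10 * u\<^sup>2) (\<lambda>u. 3 - 12 * u + 10 * u\<^sup>2) 3"
proof
  have d: "deriv (\<lambda>u::real. 1 - 8 * u + 10 * u\<^sup>2) u = - 8 + 20 * u"
    "deriv (\<lambda>u::real. 3 - 12 * u + 10 * u\<^sup>2) u = - 12 + 20 * u" for u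
    by (auto intro!: DERIV_imp_deriv derivative_eq_intros)
  show "(1 - u) * deriv (\<lambda>u. 1 - 8 * u + 10 * u\<^sup>2) u - (1 - 8 * u + 10 * u\<^sup>2)
      = - 3 * (3 - 12 * u + 10 * u\<^sup>2)"
    "3 - 12 * u + 10 * u\<^sup>2 + u * deriv (\<lambda>u. 3 - 12 * u + 10 * u\<^sup>2) u = 3 * (1 - 8 * u + 10 * u\<^sup>2)"
    for u :: real
    unfolding d by (simp_all add: power2_eq_square algebra_simps)
  show "(1 - u) * (1 - 8 * u + 10 * u\<^sup>2)\<^sup>2 + u * (3 - 12 * u + 10 * u\<^sup>2)\<^sup>2 > 0" for u :: real
  proof -
    have "(1 - u) * (1 - 8 * u + 10 * u\<^sup>2)\<^sup>2 + u * (3 - 12 * u + 10 * u\<^sup>2)\<^sup>2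
        = 20 * (u * (1 - u) - 1 / 5)\<^sup>2 + 1 / 5"
      by (simp add: power2_eq_square field_simps)
    also have "\<dots> > 0"
      by (intro add_nonneg_pos) auto
    finally show ?thesis .
  qed
  show "(3::real) > 0" by simp
qed (intro smooth_on_intros smooth_on_ident open_UNIV)+

text \<open>
  In both cases below, a function such as \<open>(1 + C) / (1 - u)\<close> has a removable singularity.
  Rationalizing the numerator moves the singularity to another point; the mediant of the two
  fractions has none.
\<close>

lemma hopf_invariant_eigenvalue_4:
  "has_hopf_invariant (torus_form (\<lambda>u. 1 - 3 * u) (\<lambda>u. 2 - 3 * u)) (- 1)"
proof -
  interpret torus_eigenform "\<lambda>u. 1 - 3 * u" "\<lambda>u. 2 - 3 * u" 2
    by (rule torus_eigenform_eigenvalue_4)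
  define s where "s u = sqrt (1 - 3 * u + 3 * u\<^sup>2)" for u :: real
  have pos: "1 - 3 * u + 3 * u\<^sup>2 > 0" for u :: real
    using N_pos[of u] unfolding N_def by (simp add: power2_eq_square algebra_simps)
  have s2: "s u * s u = 1 - 3 * u + 3 * u\<^sup>2" and s0: "s u > 0" for u
    using pos[of u] by (simp_all add: s_def)
  have s1: "s u + u > 0" for u
  proof (cases "u < 0")
    case True
    then have "(- u)\<^sup>2 < 1 - 3 * u + 3 * u\<^sup>2"
      using zero_le_power2[of u] unfolding power2_minus by linarith
    then have "- u < s u"
      unfolding s_def by (rule real_less_rsqrt)
    then show ?thesis by simp
  qed (use s0[of u] in auto)
  \<comment> \<open>The symmetry of \<open>s\<close> carries positivity of one denominator over to
    the other.\<close>
  have "s (1 - u) = s u" for u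
    by (simp add: s_def power2_eq_square algebra_simps)
  then have s1': "s u + 1 - u > 0" for u
    using s1[of "1 - u"] by simp
  have smooth: "smooth_on UNIV s"
    unfolding s_def [abs_def] using pos
    by (intro smooth_on_intros smooth_on_ident open_UNIV) auto
  have C: "C u = (1 - 2 * u) / s u" for u
  proof -
    have "N u = 1 - 3 * u + 3 * u\<^sup>2" "(1 - u) * (1 - 3 * u) + u * (2 - 3 * u) = 1 - 2 * u"
      unfolding N_def by (simp_all add: power2_eq_square algebra_simps)
    then show ?thesis
      by (simp add: C_def s_def)
  qed
  \<comment> \<open>Since \<open>s\<^sup>2 - (1 - 2 u)\<^sup>2 = u (1 - u)\<close>, the fractions
    \<open>(s + 1 - 2 u) / (1 - u)\<close> and \<open>u / (s - 1 + 2 u)\<close> agree; their mediant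
    is \<open>(s + 1 - u) / (s + u)\<close>. Its reciprocal serves for \<open>q\<close>.\<close>
  define p where "p u = (- 1) * (s u + 1 - u) / (s u * (s u + u))" for u
  define q where "q u = (s u + u) / (s u * (s u + 1 - u))" for u
  have "smooth_on UNIV p" "smooth_on UNIV q"
    unfolding p_def [abs_def] q_def [abs_def] using s0 s1 s1'
    by (intro smooth_on_intros smooth_on_ident smooth open_UNIV;
        simp add: less_imp_neq[THEN not_sym])+
  moreover have "(1 - u) * p u = - 1 - C u" for u
  proof -
    have "(1 - u) * (s u + 1 - u) = (s u + 1 - 2 * u) * (s u + u)"
      using s2[of u] by (simp add: power2_eq_square algebra_simps)
    then show ?thesis
      using s0[of u] s1[of u] unfolding p_def C by (simp add: divide_simps) (simp add: algebra_simps)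
  qed
  moreover have "u * q u = 1 - C u" for u
  proof -
    have "u * (s u + u) = (s u - 1 + 2 * u) * (s u + 1 - u)"
      using s2[of u] by (simp add: power2_eq_square algebra_simps)
    then show ?thesis
      using s0[of u] s1'[of u] unfolding q_def C by (simp add: divide_simps)
  qed
  ultimately show ?thesis
    using hopf_invariant[of p q "- 1"] by simp
qed

lemma hopf_invariant_eigenvalue_6:
  "has_hopf_invariant (torus_form (\<lambda>u. 1 - 8 * u + 10 * u\<^sup>2) (\<lambda>u. 3 - 12 * u + 10 * u\<^sup>2)) 0"
proof -
  interpret torus_eigenform "\<lambda>u. 1 - 8 * u + 10 * u\<^sup>2" "\<lambda>u. 3 - 12 * u + 10 * u\<^sup>2" 3
    by (rule torus_eigenform_eigenvalue_6)
  define w :: "real \<Rightarrow> real" where "w u = u * (1 - u)" for u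
  define s where "s u = sqrt (1 - 8 * w u + 20 * (w u)\<^sup>2)" for u
  have N: "N u = 1 - 8 * w u + 20 * (w u)\<^sup>2" for u
    unfolding N_def w_def by (simp add: power2_eq_square algebra_simps)
  have pos: "1 - 8 * w u + 20 * (w u)\<^sup>2 > 0" for u
    using N_pos[of u] by (simp add: N)
  have s2: "s u * s u = 1 - 8 * w u + 20 * (w u)\<^sup>2" and s0: "s u > 0" for u
    using pos[of u] by (simp_all add: s_def)
  \<comment> \<open>Only \<open>1 / 5 < w u \<le> 1 / 4\<close> needs an argument; there the squares
    of \<open>5 * w u - 1\<close> and \<open>s u\<close> are compared.\<close>
  have s1: "s u + 1 - 5 * w u > 0" for u
  proof (cases "w u > 1 / 5")
    case True
    have "w u = 1 / 4 - (u - 1 / 2)\<^sup>2"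
      by (simp add: w_def power2_eq_square field_simps)
    then have "w u \<le> 1 / 4"
      by simp
    with True have "0 < w u * (2 - 5 * w u)"
      by (intro mult_pos_pos) auto
    then have "(5 * w u - 1)\<^sup>2 < 1 - 8 * w u + 20 * (w u)\<^sup>2"
      by (simp add: power2_eq_square algebra_simps)
    then have "5 * w u - 1 < s u"
      unfolding s_def by (rule real_less_rsqrt)
    then show ?thesis by simp
  qed (use s0[of u] in auto)
  have smooth_w: "smooth_on UNIV w"
    unfolding w_def [abs_def] by (intro smooth_on_intros smooth_on_ident open_UNIV)
  have smooth: "smooth_on UNIV s"
    unfolding s_def [abs_def] using pos
    by (intro smooth_on_intros smooth_w open_UNIV) auto
  have C: "C u = (1 - 6 * w u) / s u" for u
  proof -
    have "(1 - u) * (1 - 8 * u + 10 * u\<^sup>2) + u * (3 - 12 * u + 10 * u\<^sup>2) = 1 - 6 * w u"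
      by (simp add: w_def power2_eq_square algebra_simps)
    then show ?thesis
      by (simp add: C_def s_def N)
  qed
  \<comment> \<open>The mediant of \<open>(s - 1 + 6 w) / w\<close> and
    \<open>4 (1 - 4 w) / (s + 1 - 6 w)\<close>, which agree because
    \<open>s\<^sup>2 - (1 - 6 w)\<^sup>2 = 4 w (1 - 4 w)\<close>, divided by
    \<open>s\<close>.\<close>
  define r where "r u = (s u + 3 - 10 * w u) / (s u * (s u + 1 - 5 * w u))" for u
  have "smooth_on UNIV r"
    unfolding r_def [abs_def] using s0 s1
    by (intro smooth_on_intros smooth_w smooth open_UNIV; simp add: less_imp_neq[THEN not_sym])
  \<comment> \<open>For \<kappa> = 1 both angular coefficients equal
    \<open>1 - C = u (1 - u) r\<close>; cancelling \<open>1 - u\<close> or \<open>u\<close> gives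
    these two functions.\<close>
  then have "smooth_on UNIV (\<lambda>u. u * r u)" "smooth_on UNIV (\<lambda>u. (1 - u) * r u)"
    by (auto intro!: smooth_on_mult smooth_on_diff smooth_on_const smooth_on_ident)
  moreover have r: "u * (1 - u) * r u = 1 - C u" for u
  proof -
    have "w u * (s u + 3 - 10 * w u) = (s u - 1 + 6 * w u) * (s u + 1 - 5 * w u)"
      using s2[of u] by (simp add: power2_eq_square algebra_simps)
    then show ?thesis
      using s0[of u] s1[of u] unfolding r_def C w_def[symmetric]
      by (simp add: divide_simps)
  qed
  ultimately show ?thesis
    using hopf_invariant[of "\<lambda>u. u * r u" "\<lambda>u. (1 - u) * r u" 1] by (simp add: mult_ac)
qed

theorem corollary1:
  fixes h :: real
  assumes "h \<in> {0, -1}"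
  shows "\<exists>\<alpha>. contact_form \<alpha> \<and> overtwisted (contact_planes \<alpha>) \<and>
           has_hopf_invariant \<alpha> h \<and> weakly_compatible round_metric \<alpha>"
proof (cases "h = 0")
  case True
  \<comment> \<open>The overtwisted disk ends at the smaller root \<open>(6 - sqrt 6) / 10\<close>
    of \<open>3 - 12 u + 10 u\<^sup>2\<close>.\<close>
  define t :: real where "t = sqrt 6"
  have t: "0 < t" "t < 6" "t * t = 6"
    using real_sqrt_less_iff[of 6 36] by (simp_all add: t_def)
  then have "0 < (6 - t) / 10" "(6 - t) / 10 < 1"
    by simp_all
  moreover have "3 - 12 * ((6 - t) / 10) + 10 * ((6 - t) / 10)\<^sup>2 = 0"
    using t(3) by (simp add: power2_eq_square field_simps)
  ultimately show ?thesis
    using torus_eigenform.contact[OF torus_eigenform_eigenvalue_6]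
      torus_eigenform.overtwisted[OF torus_eigenform_eigenvalue_6]
      torus_eigenform.weakly_compatible[OF torus_eigenform_eigenvalue_6] hopf_invariant_eigenvalue_6 True by blast
next
  case False
  with assms have h: "h = - 1" by simp
  have "overtwisted (contact_planes (torus_form (\<lambda>u. 1 - 3 * u) (\<lambda>u. 2 - 3 * u)))"
    by (rule torus_eigenform.overtwisted[OF torus_eigenform_eigenvalue_4, of "2 / 3"]) auto
  then show ?thesis
    unfolding h using torus_eigenform.contact[OF torus_eigenform_eigenvalue_4]
      torus_eigenform.weakly_compatible[OF torus_eigenform_eigenvalue_4] hopf_invariant_eigenvalue_4 by blast
qed

end
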